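(* Let $0<a<b<1$. If $$b-a<\frac14\prod_{n=1}^\infty\bigl(1-2^{-2^n}\bigr)\ (\approx 0.175092),$$ then $\mathcal J(a,b)$ has positive Hausdorff dimension. Moreover this bound is sharp: the constant $\frac14\prod_{n=1}^\infty(1-2^{-2^n})$ cannot be replaced by any larger one.
   Context: Doubling map: $T:[0,1]\to[0,1]$, $Tx=2x$ for $x\in[0,1/2]$, $Tx=2x-1$ for $x\in(1/2,1]$. For $0<a<b<1$ put $\mathcal J(a,b)=\{x\in[0,1]: T^nx\notin(a,b)\text{ for all }n\ge0\}$. *)

theory Defs
  imports "HOL-Analysis.Analysis"
begin

definition doubling :: "real \<Rightarrow> real" where
  "doubling x = (if x \<le> 1/2 then 2 * x else 2 * x - 1)"

definition avoiding_set :: "real \<Rightarrow> real \<Rightarrow> real set" where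
  "avoiding_set a b = {x \<in> {0..1}. \<forall>n. (doubling ^^ n) x \<notin> {a<..<b}}"

(* The s-th power of the diameter, with the usual conventions 0 for the empty set and
   1 for a nonempty set when s = 0 (whereas 0 powr 0 = 0 in the library). *)
definition diam_power :: "real \<Rightarrow> 'a::metric_space set \<Rightarrow> ennreal" where
  "diam_power s U =
     (if U = {} then 0 else if s = 0 then 1 else ennreal (diameter U powr s))"

(* Boundedness is required explicitly because the diameter of an unbounded set is
   an unspecified real number. *)
definition hausdorff_premeasure :: "real \<Rightarrow> real \<Rightarrow> 'a::metric_space set \<Rightarrow> ennreal" where
  "hausdorff_premeasure s \<delta> A =
     (INF U \<in> {U :: nat \<Rightarrow> 'a set. A \<subseteq> (\<Union>i. U i) \<and>
                 (\<forall>i. bounded (U i) \<and> diameter (U i) \<le> \<delta>)}.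
        (\<Sum>i. diam_power s (U i)))"

definition hausdorff_measure :: "real \<Rightarrow> 'a::metric_space set \<Rightarrow> ennreal" where
  "hausdorff_measure s A = (SUP \<delta> \<in> {0<..}. hausdorff_premeasure s \<delta> A)"

definition hausdorff_dim :: "'a::metric_space set \<Rightarrow> ennreal" where
  "hausdorff_dim A = Inf {ennreal s | s. 0 \<le> s \<and> hausdorff_measure s A = 0}"

(* The product over n \<ge> 1 is shifted, as prodinf starts at index 0. *)
definition critical_length :: real where
  "critical_length = 1/4 * (\<Prod>n. 1 - 1 / 2 ^ (2 ^ Suc n))"

end

theory Submission
  imports Defs
begin

text \<open>If all concatenations of two words of equal length, read in binary, avoid the hole, then so does
  an affine image of a self-similar Cantor set, and the dimension is positive. A few explicit pairs
  of words handle all holes of subcritical length except those close to the middle. There the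
  Thue--Morse substitution \<open>\<theta>: 0 \<mapsto> 01, 1 \<mapsto> 10\<close> takes over: it is monotone and maps the gap of a
  pair of words around \<open>1/2\<close> to the gap of the substituted pair, and the gaps obtained by iterating it
  from the pair \<open>01, 001\<close> overlap by at least the critical length.

  Conversely let \<open>t\<^sub>k\<close> be the number with digits \<open>\<theta>\<^sup>k(000...)\<close>. A point avoiding \<open>(t\<^sub>k, 1 - t\<^sub>k)\<close>
  with \<open>k > 0\<close>, other than \<open>0\<close> and \<open>1\<close>, enters the middle third, where its digits form a sequence in
  the image of \<open>\<theta>\<close> coming from a point avoiding \<open>(t\<^sub>k\<^sub>-\<^sub>1, 1 - t\<^sub>k\<^sub>-\<^sub>1)\<close>. So the avoiding set is
  countable, and the length of the hole tends to the critical one.\<close>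

section \<open>Digit expansions\<close>

type_synonym bits = "nat \<Rightarrow> bool"

definition shift :: "nat \<Rightarrow> bits \<Rightarrow> bits" where
  "shift n s = (\<lambda>i. s (n + i))"

text \<open>The digits remain 0 and 1 in every base, so for \<open>D > 2\<close> the values form a
  Cantor set of contraction ratio 1/D.\<close>

definition expansion :: "real \<Rightarrow> bits \<Rightarrow> real" where
  "expansion D s = (\<Sum>n. of_bool (s n) / D ^ Suc n)"

lemma shift_0 [simp]: "shift 0 s = s"
  by (simp add: shift_def)

lemma shift_shift [simp]: "shift m (shift n s) = shift (n + m) s"
  by (simp add: shift_def add.assoc)

lemma expansion_summable:
  fixes D :: real
  assumes "D \<ge> 2"
  shows "summable (\<lambda>n. of_bool (s n) / D ^ Suc n)"
proof (rule summable_comparison_test')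
  show "summable (\<lambda>n. (1 / D) ^ Suc n)"
    using assms by (intro summable_Suc_iff[THEN iffD2] summable_geometric) auto
  show "norm (of_bool (s n) / D ^ Suc n) \<le> (1 / D) ^ Suc n" if "n \<ge> 0" for n
    using assms by (auto simp: power_divide)
qed

lemma expansion_unfold:
  assumes "D \<ge> 2"
  shows "expansion D s = (of_bool (s 0) + expansion D (shift 1 s)) / D"
proof -
  have "expansion D s = of_bool (s 0) / D + (\<Sum>n. of_bool (s (Suc n)) / D ^ Suc (Suc n))"
    unfolding expansion_def using suminf_split_head[OF expansion_summable[OF assms, of s]] by simp
  also have "(\<Sum>n. of_bool (s (Suc n)) / D ^ Suc (Suc n)) = expansion D (shift 1 s) / D"
    unfolding expansion_def
    using suminf_divide[OF expansion_summable[OF assms, of "shift 1 s"], of D]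
    by (simp add: shift_def field_simps)
  finally show ?thesis by (simp add: add_divide_distrib)
qed

lemma expansion_nonneg: "D \<ge> 2 \<Longrightarrow> 0 \<le> expansion D s"
  unfolding expansion_def by (intro suminf_nonneg expansion_summable) auto

lemma expansion_le:
  assumes "D \<ge> 2"
  shows "expansion D s \<le> 1 / (D - 1)"
proof -
  have s: "(\<lambda>n. (1 / D) ^ Suc n) sums (1 / (1 - 1 / D) - 1)"
    using geometric_sums[of "1 / D"] assms
    by (subst sums_Suc_iff) auto
  have "expansion D s \<le> (\<Sum>n. (1 / D) ^ Suc n)"
    unfolding expansion_def
  proof (rule suminf_le[OF _ expansion_summable[OF assms] sums_summable[OF s]])
    show "of_bool (s n) / D ^ Suc n \<le> (1 / D) ^ Suc n" for n
      using assms by (simp add: power_divide del: power_Suc)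
  qed
  also have "\<dots> = 1 / (1 - 1 / D) - 1"
    using s by (rule sums_unique[symmetric])
  also have "\<dots> = 1 / (D - 1)" using assms by (simp add: field_simps)
  finally show ?thesis .
qed

lemma expansion_diff_prefix:
  assumes "D \<ge> 2" "\<And>i. i < n \<Longrightarrow> s i = t i"
  shows "expansion D s - expansion D t = (expansion D (shift n s) - expansion D (shift n t)) / D ^ n"
  using assms(2)
proof (induction n)
  case (Suc n)
  have "expansion D (shift n s) - expansion D (shift n t)
      = (expansion D (shift (Suc n) s) - expansion D (shift (Suc n) t)) / D"
    using expansion_unfold[OF assms(1), of "shift n s"] expansion_unfold[OF assms(1), of "shift n t"]
      Suc.prems[of n] by (simp add: shift_def diff_divide_distrib add_divide_distrib)
  then show ?case using Suc by simp
qed auto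

text \<open>At the first difference \<open>t\<close> gains one unit of that place, and the tail of
  \<open>s\<close> wins back at most 1/(D - 1) of it. For \<open>D = 2\<close> the bound is 0: two
  sequences may name one number.\<close>

lemma expansion_diff_ge:
  assumes "D \<ge> 2" "\<And>i. i < n \<Longrightarrow> s i = t i" "\<not> s n" "t n"
  shows "expansion D t - expansion D s \<ge> (D - 2) / (D - 1) / D ^ Suc n"
proof -
  let ?x = "expansion D (shift (Suc n) s)" and ?y = "expansion D (shift (Suc n) t)"
  have e: "expansion D t - expansion D s = (1 + ?y - ?x) / D ^ Suc n"
  proof -
    have "expansion D (shift n s) = ?x / D" "expansion D (shift n t) = (1 + ?y) / D"
      using expansion_unfold[OF assms(1), of "shift n s"] expansion_unfold[OF assms(1), of "shift n t"]
        assms(3,4) by (simp_all add: shift_def)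
    moreover have "expansion D t - expansion D s
        = (expansion D (shift n t) - expansion D (shift n s)) / D ^ n"
      using assms(2) by (intro expansion_diff_prefix[OF assms(1)]) auto
    ultimately have "expansion D t - expansion D s = ((1 + ?y) / D - ?x / D) / D ^ n" by simp
    then show ?thesis by (simp add: diff_divide_distrib divide_divide_eq_left)
  qed
  have "(D - 2) / (D - 1) = 1 - 1 / (D - 1)" using assms(1) by (simp add: field_simps)
  then have "(D - 2) / (D - 1) \<le> 1 + ?y - ?x"
    using expansion_nonneg[OF assms(1), of "shift (Suc n) t"] expansion_le[OF assms(1), of "shift (Suc n) s"]
    by linarith
  then show ?thesis unfolding e using assms(1) by (intro divide_right_mono) auto
qed

section \<open>Comparing digit sequences across bases\<close>

lemma first_difference:
  fixes s t :: bits
  assumes "s \<noteq> t"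
  obtains n where "\<And>i. i < n \<Longrightarrow> s i = t i" "s n \<noteq> t n"
proof
  define n where "n = (LEAST n. s n \<noteq> t n)"
  have "\<exists>n. s n \<noteq> t n" using assms by (simp add: fun_eq_iff)
  then show "s n \<noteq> t n" unfolding n_def by (rule LeastI_ex)
  show "s i = t i" if "i < n" for i
    using not_less_Least[OF that[unfolded n_def]] by simp
qed

text \<open>A strict inequality in any base fixes the lexicographic order, which bases above 2
  reflect strictly.\<close>

lemma expansion_less_transfer:
  assumes "D \<ge> 2" "D' > 2" "expansion D s < expansion D t"
  shows "expansion D' s < expansion D' t"
proof -
  have "s \<noteq> t" using assms(3) by auto
  then obtain n where n: "\<And>i. i < n \<Longrightarrow> s i = t i" "s n \<noteq> t n"
    using first_difference by blast
  have "\<not> (s n \<and> \<not> t n)"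
  proof
    assume "s n \<and> \<not> t n"
    then have "(D - 2) / (D - 1) / D ^ Suc n \<le> expansion D s - expansion D t"
      using n(2) assms(1) by (intro expansion_diff_ge n(1) n(1)[symmetric]) auto
    moreover have "(D - 2) / (D - 1) / D ^ Suc n \<ge> 0" using assms(1) by simp
    ultimately show False using assms(3) by linarith
  qed
  then have "(D' - 2) / (D' - 1) / D' ^ Suc n \<le> expansion D' t - expansion D' s"
    using n(2) assms(2) by (intro expansion_diff_ge n(1)) auto
  moreover have "(D' - 2) / (D' - 1) / D' ^ Suc n > 0" using assms(2) by simp
  ultimately show ?thesis by linarith
qed

lemma expansion_le_transfer:
  assumes "D > 2" "D' \<ge> 2" "expansion D s \<le> expansion D t"
  shows "expansion D' s \<le> expansion D' t"
  using expansion_less_transfer[OF assms(2,1), of t s] assms(3) by (meson not_le)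

lemma expansion_zero [simp]: "expansion D (\<lambda>_. False) = 0"
  by (simp add: expansion_def)

lemma expansion_compl:
  assumes "D \<ge> 2"
  shows "expansion D (\<lambda>n. \<not> s n) = 1 / (D - 1) - expansion D s"
proof -
  have s: "(\<lambda>n. (1 / D) ^ Suc n) sums (1 / (1 - 1 / D) - 1)"
    using geometric_sums[of "1 / D"] assms
    by (subst sums_Suc_iff) auto
  have eq: "of_bool (\<not> s n) / D ^ Suc n = (1 / D) ^ Suc n - of_bool (s n) / D ^ Suc n" for n
    by (simp add: power_divide)
  have "expansion D (\<lambda>n. \<not> s n) = (\<Sum>n. (1 / D) ^ Suc n) - expansion D s"
    unfolding expansion_def eq
    by (rule suminf_diff[OF sums_summable[OF s] expansion_summable[OF assms], symmetric])
  also have "(\<Sum>n. (1 / D) ^ Suc n) = 1 / (1 - 1 / D) - 1"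
    using s by (rule sums_unique[symmetric])
  also have "1 / (1 - 1 / D) - 1 = 1 / (D - 1)" using assms by (simp add: field_simps)
  finally show ?thesis .
qed

text \<open>Here \<open>h n\<close> will be an error after n shifts; pulling a bounded error back n
  steps divides it by 2^n.\<close>

lemma bounded_contraction_zero:
  fixes h :: "nat \<Rightarrow> real"
  assumes "\<And>n. \<bar>h n\<bar> \<le> C" "\<And>n. \<bar>h n\<bar> \<le> \<bar>h (Suc n)\<bar> / 2"
  shows "h 0 = 0"
proof -
  have "\<bar>h 0\<bar> \<le> \<bar>h n\<bar> / 2 ^ n" for n
  proof (induction n)
    case (Suc n)
    have "\<bar>h n\<bar> / 2 ^ n \<le> (\<bar>h (Suc n)\<bar> / 2) / 2 ^ n"
      using assms(2) by (intro divide_right_mono) auto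
    then show ?case using Suc by simp
  qed auto
  moreover have "\<bar>h n\<bar> / 2 ^ n \<le> C / 2 ^ n" for n
    using assms(1) by (intro divide_right_mono) auto
  ultimately have "\<bar>h 0\<bar> \<le> C / 2 ^ n" for n
    by (rule order_trans)
  then have "\<bar>h 0\<bar> \<le> C * (1 / 2) ^ n" for n
    by (simp add: power_divide)
  moreover have "(\<lambda>n. C * (1 / 2) ^ n) \<longlonglongrightarrow> C * 0"
    by (intro tendsto_intros LIMSEQ_power_zero) auto
  ultimately have "\<bar>h 0\<bar> \<le> 0"
    by (intro tendsto_lowerbound[of _ 0 sequentially "\<bar>h 0\<bar>"]) auto
  then show ?thesis by simp
qed

text \<open>The right-hand side solves the same equation, so the difference is divided by
  \<open>D\<close> at each shift and, being bounded, vanishes. Affine formulas can thus be proved by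
  looking at one block.\<close>

lemma expansion_unique:
  assumes "D \<ge> 2" and bounded: "\<And>c. \<bar>f c\<bar> \<le> C"
    and step: "\<And>c. f c = (x + y * of_bool (c 0) + f (shift 1 c)) / D"
  shows "f c = x / (D - 1) + y * expansion D c"
proof -
  define h where "h n = f (shift n c) - (x / (D - 1) + y * expansion D (shift n c))" for n
  have h: "\<bar>h n\<bar> = \<bar>h (Suc n)\<bar> / D" for n
  proof -
    define v w b where "v = expansion D (shift (Suc n) c)" and "w = f (shift (Suc n) c)"
      and "b = (of_bool (c n) :: real)"
    have "f (shift n c) = (x + y * b + w) / D" "expansion D (shift n c) = (b + v) / D"
      using step[of "shift n c"] expansion_unfold[OF assms(1), of "shift n c"]
      by (simp_all add: v_def w_def b_def shift_def)
    then have "h n = (x + y * b + w) / D - (x / (D - 1) + y * ((b + v) / D))"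
      by (simp add: h_def)
    also have "\<dots> = (w - (x / (D - 1) + y * v)) / D"
      using assms(1) by (simp add: field_simps)
    finally have "h n = h (Suc n) / D" by (simp add: h_def v_def w_def)
    then show ?thesis using assms(1) by simp
  qed
  have "h 0 = 0"
  proof (rule bounded_contraction_zero)
    show "\<bar>h n\<bar> \<le> C + (\<bar>x / (D - 1)\<bar> + \<bar>y\<bar> * (1 / (D - 1)))" for n
    proof -
      have "\<bar>y * expansion D (shift n c)\<bar> \<le> \<bar>y\<bar> * (1 / (D - 1))"
        using expansion_nonneg[OF assms(1), of "shift n c"] expansion_le[OF assms(1), of "shift n c"]
          mult_left_mono[of "expansion D (shift n c)" "1 / (D - 1)" "\<bar>y\<bar>"]
        by (simp add: abs_mult)
      then show ?thesis unfolding h_def using bounded[of "shift n c"] by linarith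
    qed
    show "\<bar>h n\<bar> \<le> \<bar>h (Suc n)\<bar> / 2" for n
      unfolding h[of n] using assms(1) by (intro divide_left_mono) auto
  qed
  then show ?thesis by (simp add: h_def)
qed

section \<open>Hausdorff dimension\<close>

text \<open>The strict inequality matches \<open>doubling\<close>, which sends 1/2 to 1: dyadic
  points of (0,1) get the expansion ending in ones.\<close>

definition itinerary :: "real \<Rightarrow> bits" where
  "itinerary x = (\<lambda>n. (doubling ^^ n) x > 1/2)"

lemma doubling_funpow_in_unit: "x \<in> {0..1} \<Longrightarrow> (doubling ^^ n) x \<in> {0..1}"
  by (induction n) (auto simp: doubling_def)

lemma shift_itinerary: "shift n (itinerary x) = itinerary ((doubling ^^ n) x)"
proof -
  have "(doubling ^^ (n + i)) x = (doubling ^^ i) ((doubling ^^ n) x)" for i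
    by (subst add.commute) (simp add: funpow_add)
  then show ?thesis by (simp add: itinerary_def shift_def)
qed

lemma expansion_itinerary:
  assumes "x \<in> {0..1}"
  shows "expansion 2 (itinerary x) = x"
proof -
  define h where "h n = expansion 2 (itinerary ((doubling ^^ n) x)) - (doubling ^^ n) x" for n
  have "h 0 = 0"
  proof (rule bounded_contraction_zero)
    show "\<bar>h n\<bar> \<le> 1" for n
      using doubling_funpow_in_unit[OF assms, of n]
        expansion_nonneg[of 2 "itinerary ((doubling ^^ n) x)"]
        expansion_le[of 2 "itinerary ((doubling ^^ n) x)"]
      by (auto simp: h_def)
    show "\<bar>h n\<bar> \<le> \<bar>h (Suc n)\<bar> / 2" for n
    proof -
      define z where "z = (doubling ^^ n) x"
      have "expansion 2 (itinerary z) = (of_bool (z > 1/2) + expansion 2 (itinerary (doubling z))) / 2"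
        using expansion_unfold[of 2 "itinerary z"] shift_itinerary[of 1 z]
        by (simp add: itinerary_def)
      moreover have "doubling z = 2 * z - of_bool (z > 1/2)" by (simp add: doubling_def)
      ultimately have "h n = h (Suc n) / 2" by (simp add: h_def z_def)
      then show ?thesis by simp
    qed
  qed
  then show ?thesis by (simp add: h_def)
qed

text \<open>Sequences that first differ at place n are at least a constant times D^-n apart in base
  \<open>D\<close> and at most 2^-n apart in base 2; raising D^-n to the power
  \<open>log D 2\<close> gives 2^-n.\<close>

lemma expansion_hoelder:
  assumes "D > 2" "\<beta> \<noteq> 0"
  obtains K where "K > 0" "\<And>c c'. \<bar>expansion 2 c - expansion 2 c'\<bar>
      \<le> K * \<bar>\<beta> * (expansion D c - expansion D c')\<bar> powr log D 2"
proof
  define \<kappa> where "\<kappa> = \<bar>\<beta>\<bar> * ((D - 2) / (D - 1) / D)"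
  have \<kappa>: "\<kappa> > 0" using assms by (simp add: \<kappa>_def)
  have pos: "log D 2 > 0" using assms by simp
  show "\<kappa> powr (- log D 2) > 0" using \<kappa> by simp
  show "\<bar>expansion 2 c - expansion 2 c'\<bar>
      \<le> \<kappa> powr (- log D 2) * \<bar>\<beta> * (expansion D c - expansion D c')\<bar> powr log D 2" for c c'
  proof (cases "c = c'")
    case False
    then obtain n where n: "\<And>i. i < n \<Longrightarrow> c i = c' i" "c n \<noteq> c' n"
      using first_difference by blast
    have "(D - 2) / (D - 1) / D ^ Suc n \<le> \<bar>expansion D c - expansion D c'\<bar>"
    proof (cases "c n")
      case True
      then have "(D - 2) / (D - 1) / D ^ Suc n \<le> expansion D c - expansion D c'"
        using n(2) assms(1) by (intro expansion_diff_ge n(1)[symmetric]) auto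
      then show ?thesis by linarith
    next
      case False
      then have "(D - 2) / (D - 1) / D ^ Suc n \<le> expansion D c' - expansion D c"
        using n(2) assms(1) by (intro expansion_diff_ge n(1)) auto
      then show ?thesis by linarith
    qed
    then have "\<bar>\<beta>\<bar> * ((D - 2) / (D - 1) / D ^ Suc n) \<le> \<bar>\<beta> * (expansion D c - expansion D c')\<bar>"
      unfolding abs_mult by (rule mult_left_mono) simp
    moreover have "\<kappa> * (1 / D) ^ n = \<bar>\<beta>\<bar> * ((D - 2) / (D - 1) / D ^ Suc n)"
      by (simp add: \<kappa>_def power_divide)
    ultimately have le: "\<kappa> * (1 / D) ^ n \<le> \<bar>\<beta> * (expansion D c - expansion D c')\<bar>" by simp
    have pw: "((1 / D) ^ n) powr log D 2 = (1 / 2) ^ n"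
    proof -
      have "(1 / D) powr log D 2 = 1 / 2"
        using assms(1) by (simp add: powr_divide)
      moreover have "((1 / D) ^ n) powr log D 2 = ((1 / D) powr log D 2) ^ n"
        using assms(1) by (simp add: powr_powr mult.commute flip: powr_realpow)
      ultimately show ?thesis by (simp only:)
    qed
    have "\<bar>expansion 2 c - expansion 2 c'\<bar> = \<bar>expansion 2 (shift n c) - expansion 2 (shift n c')\<bar> / 2 ^ n"
      by (subst expansion_diff_prefix[of 2 n, OF _ n(1)]) auto
    also have "\<dots> \<le> 1 / 2 ^ n"
      using expansion_nonneg[of 2 "shift n c"] expansion_le[of 2 "shift n c"]
        expansion_nonneg[of 2 "shift n c'"] expansion_le[of 2 "shift n c'"]
      by (intro divide_right_mono) auto
    also have "\<dots> = \<kappa> powr (- log D 2) * (\<kappa> * (1 / D) ^ n) powr log D 2"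
      unfolding powr_mult[of \<kappa> "(1 / D) ^ n"] pw using \<kappa> assms(1)
      by (simp add: powr_minus power_divide)
    also have "\<dots> \<le> \<kappa> powr (- log D 2) * \<bar>\<beta> * (expansion D c - expansion D c')\<bar> powr log D 2"
      using \<kappa> assms(1) le pos by (intro mult_left_mono powr_mono2) auto
    finally show ?thesis .
  qed simp
qed

text \<open>Lets one estimate at exponent \<open>r\<close> serve every \<open>s\<close> up to
  \<open>r\<close>, including the special conventions at s = 0 and for the empty set.\<close>

lemma diam_power_mono_exponent:
  assumes "0 \<le> s" "s \<le> r" "0 < r" "bounded U" "diameter U \<le> 1"
  shows "ennreal (diameter U powr r) \<le> diam_power s U"
proof -
  have d: "diameter U \<ge> 0" using diameter_ge_0[OF assms(4)] .
  consider "U = {}" | "U \<noteq> {}" "s = 0" | "U \<noteq> {}" "s > 0" using assms(1) by force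
  then show ?thesis
  proof cases
    case 1
    then show ?thesis using assms(3) by (simp add: diameter_empty)
  next
    case 2
    have "diameter U powr r \<le> 1"
      using d assms by (intro powr_le1) auto
    then show ?thesis using 2 by (simp add: diam_power_def)
  next
    case 3
    have "diameter U powr r \<le> diameter U powr s"
      using d assms by (intro powr_mono') auto
    then show ?thesis using 3 by (simp add: diam_power_def ennreal_leI)
  qed
qed

text \<open>Reading the digits in base 2 instead of base D maps the Cantor set onto the unit interval,
  and this map is Hoelder continuous of exponent \<open>log D 2\<close>.\<close>

lemma hausdorff_dim_pos:
  assumes "D > 2" "\<beta> \<noteq> 0" and sub: "\<And>c. \<alpha> + \<beta> * expansion D c \<in> E"
  shows "hausdorff_dim E > 0"
proof -
  define r where "r = log D 2"
  have r: "r > 0" using assms by (simp add: r_def)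
  obtain K where K: "K > 0" "\<And>c c'. \<bar>expansion 2 c - expansion 2 c'\<bar>
      \<le> K * \<bar>\<beta> * (expansion D c - expansion D c')\<bar> powr r"
    using expansion_hoelder[OF assms(1,2)] unfolding r_def by metis
  \<comment> \<open>The base change carries \<open>U i\<close> into an interval of radius
    \<open>d i\<close>. These intervals cover [0, 1], so their total length is at least 1.\<close>
  have cover: "ennreal (1 / (2 * K)) \<le> (\<Sum>i. diam_power s (U i))"
    if s: "0 \<le> s" "s \<le> r" and U: "E \<subseteq> (\<Union>i. U i)" "\<And>i. bounded (U i)" "\<And>i. diameter (U i) \<le> 1"
    for s and U :: "nat \<Rightarrow> real set"
  proof -
    define d where "d i = K * diameter (U i) powr r" for i
    have d: "d i \<ge> 0" for i using K(1) by (simp add: d_def)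
    have "\<exists>x. \<forall>c. \<alpha> + \<beta> * expansion D c \<in> U i \<longrightarrow> expansion 2 c \<in> {x - d i..x + d i}" for i
    proof (cases "\<exists>c. \<alpha> + \<beta> * expansion D c \<in> U i")
      case True
      then obtain c0 where c0: "\<alpha> + \<beta> * expansion D c0 \<in> U i" by blast
      have "expansion 2 c \<in> {expansion 2 c0 - d i..expansion 2 c0 + d i}"
        if c: "\<alpha> + \<beta> * expansion D c \<in> U i" for c
      proof -
        have "\<bar>\<beta> * (expansion D c - expansion D c0)\<bar> \<le> diameter (U i)"
          using diameter_bounded_bound[OF U(2) c c0] by (simp add: dist_real_def algebra_simps)
        then have "\<bar>\<beta> * (expansion D c - expansion D c0)\<bar> powr r \<le> diameter (U i) powr r"
          using r by (intro powr_mono2) auto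
        then have "\<bar>expansion 2 c - expansion 2 c0\<bar> \<le> d i"
          using K(2)[of c c0] K(1) unfolding d_def by (meson mult_le_cancel_left_pos order_trans)
        then show ?thesis by auto
      qed
      then show ?thesis by blast
    qed auto
    then obtain x where x: "\<And>i c. \<alpha> + \<beta> * expansion D c \<in> U i \<Longrightarrow> expansion 2 c \<in> {x i - d i..x i + d i}"
      by metis
    have "{0..1} \<subseteq> (\<Union>i. {x i - d i..x i + d i})"
    proof
      fix y :: real assume "y \<in> {0..1}"
      then have y: "expansion 2 (itinerary y) = y" by (rule expansion_itinerary)
      obtain i where "\<alpha> + \<beta> * expansion D (itinerary y) \<in> U i"
        using sub[of "itinerary y"] U(1) by blast
      from x[OF this] show "y \<in> (\<Union>i. {x i - d i..x i + d i})" unfolding y by blast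
    qed
    then have "emeasure lborel {0..1::real} \<le> emeasure lborel (\<Union>i. {x i - d i..x i + d i})"
      by (rule emeasure_mono) auto
    also have "\<dots> \<le> (\<Sum>i. emeasure lborel {x i - d i..x i + d i})"
      by (rule emeasure_subadditive_countably) auto
    also have "\<dots> = (\<Sum>i. ennreal (2 * K) * ennreal (diameter (U i) powr r))"
      using d K(1) by (intro suminf_cong) (simp add: d_def mult.assoc flip: ennreal_mult)
    also have "\<dots> \<le> (\<Sum>i. ennreal (2 * K) * diam_power s (U i))"
      using diam_power_mono_exponent[OF s r U(2,3)] by (intro suminf_le mult_left_mono) auto
    also have "\<dots> = ennreal (2 * K) * (\<Sum>i. diam_power s (U i))"
      by simp
    finally have "1 \<le> ennreal (2 * K) * (\<Sum>i. diam_power s (U i))" by simp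
    then have "ennreal (1 / (2 * K)) * 1 \<le> ennreal (1 / (2 * K)) * (ennreal (2 * K) * (\<Sum>i. diam_power s (U i)))"
      by (intro mult_left_mono) auto
    also have "\<dots> = (\<Sum>i. diam_power s (U i))"
      using K(1) by (simp add: mult.assoc[symmetric] flip: ennreal_mult)
    finally show ?thesis by simp
  qed
  have pos: "hausdorff_measure s E \<noteq> 0" if s: "0 \<le> s" "s \<le> r" for s
  proof -
    have "ennreal (1 / (2 * K)) \<le> hausdorff_premeasure s 1 E"
      unfolding hausdorff_premeasure_def using cover[OF s] by (intro INF_greatest) auto
    also have "\<dots> \<le> hausdorff_measure s E"
      unfolding hausdorff_measure_def by (intro SUP_upper) auto
    finally have "ennreal (1 / (2 * K)) \<le> hausdorff_measure s E" .
    moreover have "ennreal (1 / (2 * K)) > 0" using K(1) by simp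
    ultimately show ?thesis by auto
  qed
  have "ennreal r \<le> hausdorff_dim E"
    unfolding hausdorff_dim_def using pos
    by (intro Inf_greatest) (force intro!: ennreal_leI)
  moreover have "ennreal r > 0" using r by simp
  ultimately show ?thesis by (rule less_le_trans[rotated])
qed

text \<open>For every s > 0 a cover by singletons costs nothing at any scale.\<close>

lemma hausdorff_dim_countable:
  fixes A :: "real set"
  assumes "countable A"
  shows "hausdorff_dim A = 0"
proof -
  have "hausdorff_measure s A = 0" if "s > 0" for s
  proof -
    have "hausdorff_premeasure s \<delta> A \<le> 0" if "\<delta> > 0" for \<delta>
    proof -
      have "\<exists>U :: nat \<Rightarrow> real set. A \<subseteq> (\<Union>i. U i) \<and> (\<forall>i. \<exists>x. U i = {x})"
        by (rule exI[of _ "\<lambda>i. {from_nat_into A i}"]) (use assms in \<open>auto dest: from_nat_into_surj\<close>)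
      then obtain U :: "nat \<Rightarrow> real set" where U: "A \<subseteq> (\<Union>i. U i)" "\<And>i. \<exists>x. U i = {x}" by blast
      have "bounded (U i) \<and> diameter (U i) \<le> \<delta> \<and> diam_power s (U i) = 0" for i
        using U(2)[of i] \<open>s > 0\<close> \<open>\<delta> > 0\<close> by (auto simp: diam_power_def)
      then have "(\<Sum>i. diam_power s (U i)) = 0" "\<forall>i. bounded (U i) \<and> diameter (U i) \<le> \<delta>" by auto
      then show ?thesis unfolding hausdorff_premeasure_def using U(1)
        by (intro INF_lower2[of U]) auto
    qed
    then show ?thesis
      unfolding hausdorff_measure_def by (intro antisym SUP_least) auto
  qed
  then have "hausdorff_dim A \<le> ennreal s" if "s > 0" for s
    unfolding hausdorff_dim_def using that by (intro Inf_lower) auto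
  then show ?thesis
    by (metis ennreal_le_epsilon add_0 le_zero_eq zero_le)
qed

section \<open>Orbits of the doubling map\<close>

text \<open>Excludes the eventually constant sequences, whose values are dyadic; on the others the
  shift follows \<open>doubling\<close>.\<close>

definition recurrent :: "bits \<Rightarrow> bool" where
  "recurrent s \<longleftrightarrow> (\<forall>n. (\<exists>m\<ge>n. s m) \<and> (\<exists>m\<ge>n. \<not> s m))"

lemma recurrent_shift:
  assumes "recurrent s"
  shows "recurrent (shift n s)"
proof -
  have "\<exists>m\<ge>k. shift n s m = b" if "\<exists>m\<ge>n + k. s m = b" for k b
  proof -
    from that obtain m where "m \<ge> n + k" "s m = b" by blast
    then show ?thesis by (intro exI[of _ "m - n"]) (auto simp: shift_def)
  qed
  from this[of _ True] this[of _ False] assms show ?thesis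
    unfolding recurrent_def by simp
qed

lemma recurrent_compl: "recurrent s \<Longrightarrow> recurrent (\<lambda>n. \<not> s n)"
  unfolding recurrent_def by blast

lemma expansion_pos:
  assumes "D \<ge> 2" "s m"
  shows "expansion D s > 0"
proof -
  have "of_bool (s m) / D ^ Suc m \<le> expansion D s"
    unfolding expansion_def
    using sum_le_suminf[OF expansion_summable[OF assms(1)], of "{m}" s] assms(1) by simp
  moreover have "0 < of_bool (s m) / D ^ Suc m" using assms by simp
  ultimately show ?thesis by linarith
qed

text \<open>The second digit expansion of a dyadic rational, ending in zeros, does not follow the
  orbit of \<open>doubling\<close>, which sends \<open>1/2\<close> to \<open>1\<close>.\<close>

lemma doubling_expansion:
  assumes "recurrent s"
  shows "doubling (expansion 2 s) = expansion 2 (shift 1 s)"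
proof (cases "s 0")
  case True
  obtain m where "shift 1 s m"
    using recurrent_shift[OF assms, of 1] unfolding recurrent_def by blast
  then have "expansion 2 (shift 1 s) > 0" by (intro expansion_pos) auto
  then show ?thesis using True expansion_unfold[of 2 s] by (simp add: doubling_def)
next
  case False
  then show ?thesis using expansion_unfold[of 2 s] expansion_le[of 2 "shift 1 s"]
    by (simp add: doubling_def)
qed

lemma doubling_funpow_expansion:
  "recurrent s \<Longrightarrow> (doubling ^^ n) (expansion 2 s) = expansion 2 (shift n s)"
  by (induction n) (auto simp: doubling_expansion recurrent_shift)

text \<open>A certificate for positive dimension: the orbits of an affine copy of a Cantor set miss
  the hole.\<close>

definition thin_hole :: "real \<Rightarrow> real \<Rightarrow> bool" where
  "thin_hole a b \<longleftrightarrow> (\<exists>F D \<alpha> \<beta>. D > 2 \<and> \<beta> \<noteq> 0 \<and>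
     (\<forall>c. recurrent (F c) \<and> expansion 2 (F c) = \<alpha> + \<beta> * expansion D c \<and>
          (\<forall>n. expansion 2 (shift n (F c)) \<notin> {a<..<b})))"

lemma thin_hole_dim_pos:
  assumes "thin_hole a b"
  shows "hausdorff_dim (avoiding_set a b) > 0"
proof -
  obtain F D \<alpha> \<beta> where F: "D > 2" "\<beta> \<noteq> 0"
    "\<And>c. recurrent (F c)" "\<And>c. expansion 2 (F c) = \<alpha> + \<beta> * expansion D c"
    "\<And>c n. expansion 2 (shift n (F c)) \<notin> {a<..<b}"
    using assms unfolding thin_hole_def by metis
  have "expansion 2 (F c) \<in> avoiding_set a b" for c
    using expansion_nonneg[of 2 "F c"] expansion_le[of 2 "F c"] F(5)[where c = c]
    by (simp add: avoiding_set_def doubling_funpow_expansion[OF F(3)])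
  then show ?thesis
    using F(4) by (intro hausdorff_dim_pos[OF F(1,2), of \<alpha>]) metis
qed

lemma thin_hole_mono:
  assumes "thin_hole a b" "a \<le> a'" "b' \<le> b"
  shows "thin_hole a' b'"
proof -
  have "x \<notin> {a'<..<b'}" if "x \<notin> {a<..<b}" for x using that assms(2,3) by auto
  then show ?thesis using assms(1) unfolding thin_hole_def by meson
qed

text \<open>Complementing all digits maps x to 1 - x and commutes with shifts; the scale factor
  changes sign.\<close>

lemma thin_hole_reflect:
  assumes "thin_hole a b"
  shows "thin_hole (1 - b) (1 - a)"
proof -
  obtain F D \<alpha> \<beta> where F: "D > 2" "\<beta> \<noteq> 0"
    "\<And>c. recurrent (F c)" "\<And>c. expansion 2 (F c) = \<alpha> + \<beta> * expansion D c"
    "\<And>c n. expansion 2 (shift n (F c)) \<notin> {a<..<b}"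
    using assms unfolding thin_hole_def by metis
  define G where "G c = (\<lambda>n. \<not> F c n)" for c
  have sh: "shift n (G c) = (\<lambda>i. \<not> shift n (F c) i)" for n c
    by (simp add: G_def shift_def)
  have "D > 2 \<and> - \<beta> \<noteq> 0 \<and> (\<forall>c. recurrent (G c) \<and> expansion 2 (G c) = (1 - \<alpha>) + (- \<beta>) * expansion D c \<and>
          (\<forall>n. expansion 2 (shift n (G c)) \<notin> {1 - b<..<1 - a}))"
  proof (intro conjI allI)
    show "expansion 2 (shift n (G c)) \<notin> {1 - b<..<1 - a}" for c n
      using F(5)[of n c] unfolding sh by (auto simp: expansion_compl)
    show "expansion 2 (G c) = (1 - \<alpha>) + (- \<beta>) * expansion D c" for c
      by (simp add: G_def expansion_compl F(4))
  qed (use F in \<open>auto simp: G_def intro: recurrent_compl\<close>)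
  then show ?thesis unfolding thin_hole_def by blast
qed

section \<open>Concatenations of two words\<close>

fun prepend :: "bool list \<Rightarrow> bits \<Rightarrow> bits" where
  "prepend [] s = s"
| "prepend (b # u) s = case_nat b (prepend u s)"

fun numeral_value :: "real \<Rightarrow> bool list \<Rightarrow> real" where
  "numeral_value D [] = 0"
| "numeral_value D (b # u) = of_bool b * D ^ length u + numeral_value D u"

lemma prepend_nth: "prepend u s i = (if i < length u then u ! i else s (i - length u))"
  by (induction u arbitrary: i) (auto split: nat.split)

lemma shift_case_nat: "shift (Suc 0) (case_nat b s) = s"
  by (simp add: shift_def)

lemma expansion_prepend:
  assumes "D \<ge> 2"
  shows "expansion D (prepend u s) = (numeral_value D u + expansion D s) / D ^ length u"
proof (induction u)
  case (Cons b u)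
  then show ?case using assms
    by (simp add: expansion_unfold[OF assms, of "case_nat b _"] shift_case_nat field_simps)
qed simp

definition concat_words :: "bool list \<Rightarrow> bool list \<Rightarrow> bits \<Rightarrow> bits" where
  "concat_words u v c = (\<lambda>n. (if c (n div length u) then v else u) ! (n mod length u))"

text \<open>Every shift is thus a suffix of one of the two words followed by another concatenation,
  so only finitely many suffixes have to be examined.\<close>

lemma shift_concat_words:
  assumes "length v = length u" "r < length u"
  shows "shift (length u * j + r) (concat_words u v c)
    = prepend (drop r (if c j then v else u)) (concat_words u v (shift (Suc j) c))"
proof
  fix i
  let ?L = "length u"
  have L: "?L \<noteq> 0" using assms(2) by linarith
  show "shift (?L * j + r) (concat_words u v c) i
      = prepend (drop r (if c j then v else u)) (concat_words u v (shift (Suc j) c)) i"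
  proof (cases "r + i < ?L")
    case True
    have "(?L * j + r + i) div ?L = j" "(?L * j + r + i) mod ?L = r + i"
      using True assms(2) by (simp_all only: add.assoc div_mult_self4[OF L] mod_mult_self4 div_less mod_less add_0_right)
    then show ?thesis using assms True by (auto simp: shift_def concat_words_def prepend_nth)
  next
    case False
    define i' where "i' = r + i - ?L"
    have i: "?L * j + r + i = ?L * Suc j + i'" "i - (?L - r) = i'"
      using False assms(2) by (simp_all add: i'_def)
    have dm: "(?L * Suc j + i') div ?L = Suc j + i' div ?L" "(?L * Suc j + i') mod ?L = i' mod ?L"
      by (simp_all only: div_mult_self4[OF L] mod_mult_self4)
    have "shift (?L * j + r) (concat_words u v c) i = concat_words u v (shift (Suc j) c) i'"
      by (simp only: shift_def concat_words_def i(1) dm)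
    moreover have "length (drop r (if c j then v else u)) = ?L - r" using assms(1) by simp
    moreover have "\<not> i < ?L - r" using False by linarith
    ultimately show ?thesis using i(2) by (simp only: prepend_nth if_False)
  qed
qed

text \<open>A block of length L in base \<open>D\<close> acts as a single digit in base D^L.\<close>

lemma expansion_concat_words:
  assumes "D \<ge> 2" "length v = length u" "u \<noteq> []"
  shows "expansion D (concat_words u v c) = numeral_value D u / (D ^ length u - 1)
    + (numeral_value D v - numeral_value D u) * expansion (D ^ length u) c"
proof (rule expansion_unique)
  show "D ^ length u \<ge> 2"
    using power_increasing[of 1 "length u" D] assms(1,3) by (simp add: Suc_le_eq)
  show "\<bar>expansion D (concat_words u v c)\<bar> \<le> 1 / (D - 1)" for c
    using expansion_nonneg[OF assms(1)] expansion_le[OF assms(1)] by simp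
  show "expansion D (concat_words u v c) = (numeral_value D u
      + (numeral_value D v - numeral_value D u) * of_bool (c 0)
      + expansion D (concat_words u v (shift 1 c))) / D ^ length u" for c
    using shift_concat_words[OF assms(2), of 0 0 c] assms
    by (auto simp: expansion_prepend)
qed

text \<open>\<open>y\<close> stands for the value of what follows the word. Denominators are cleared
  so that concrete words yield linear inequalities in \<open>y\<close>.\<close>

fun suffixes_avoid :: "real \<Rightarrow> real \<Rightarrow> real \<Rightarrow> real \<Rightarrow> bool list \<Rightarrow> bool" where
  "suffixes_avoid D a b y [] \<longleftrightarrow> True"
| "suffixes_avoid D a b y (x # u) \<longleftrightarrow>
     (numeral_value D (x # u) + y \<le> a * D ^ length (x # u) \<or>
      b * D ^ length (x # u) \<le> numeral_value D (x # u) + y) \<and> suffixes_avoid D a b y u"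

lemma suffixes_avoid_drop:
  assumes "suffixes_avoid D a b y w" "r < length w" "D \<ge> 2"
  shows "(numeral_value D (drop r w) + y) / D ^ length (drop r w) \<notin> {a<..<b}"
  using assms(1,2)
proof (induction w arbitrary: r)
  case (Cons x w)
  show ?case
  proof (cases r)
    case 0
    have "D ^ length (x # w) > 0" using assms(3) by simp
    then show ?thesis using Cons.prems(1) 0
      by (auto simp: pos_less_divide_eq pos_divide_less_eq simp del: power_Suc)
  next
    case (Suc r')
    then show ?thesis using Cons by simp
  qed
qed simp

text \<open>The tail after a block is again a concatenation, so its value lies between those of
  \<open>u\<close> repeated and \<open>v\<close> repeated.\<close>

lemma concat_words_avoid:
  assumes "D \<ge> 2" "length v = length u" "u \<noteq> []" "numeral_value D u \<le> numeral_value D v"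
    and "\<And>y. numeral_value D u \<le> (D ^ length u - 1) * y \<Longrightarrow> (D ^ length u - 1) * y \<le> numeral_value D v \<Longrightarrow>
           suffixes_avoid D a b y u \<and> suffixes_avoid D a b y v"
  shows "expansion D (shift n (concat_words u v c)) \<notin> {a<..<b}"
proof -
  define j r where "j = n div length u" and "r = n mod length u"
  have n: "n = length u * j + r" and r: "r < length u"
    using assms(3) by (simp_all add: j_def r_def)
  define y where "y = expansion D (concat_words u v (shift (Suc j) c))"
  have D: "D ^ length u \<ge> 2"
    using power_increasing[of 1 "length u" D] assms(1,3) by (simp add: Suc_le_eq)
  have "(numeral_value D v - numeral_value D u) * expansion (D ^ length u) (shift (Suc j) c)
      \<le> (numeral_value D v - numeral_value D u) * (1 / (D ^ length u - 1))"
    using expansion_le[OF D] assms(4) by (intro mult_left_mono) auto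
  moreover have "(numeral_value D v - numeral_value D u) * expansion (D ^ length u) (shift (Suc j) c) \<ge> 0"
    using expansion_nonneg[OF D] assms(4) by simp
  ultimately have "numeral_value D u / (D ^ length u - 1) \<le> y" "y \<le> numeral_value D v / (D ^ length u - 1)"
    unfolding y_def expansion_concat_words[OF assms(1-3)] by (simp_all add: diff_divide_distrib)
  then have y: "numeral_value D u \<le> (D ^ length u - 1) * y" "(D ^ length u - 1) * y \<le> numeral_value D v"
    using D by (simp_all add: field_simps)
  show ?thesis
    unfolding n shift_concat_words[OF assms(2) r] expansion_prepend[OF assms(1)] y_def[symmetric]
    using assms(5)[OF y] r assms(1,2) by (intro suffixes_avoid_drop) auto
qed

lemma recurrent_concat_words:
  assumes "length v = length u" "True \<in> set u" "True \<in> set v" "False \<in> set u" "False \<in> set v"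
  shows "recurrent (concat_words u v c)"
proof -
  have "\<exists>m\<ge>n. concat_words u v c m = b" if "b \<in> set u" "b \<in> set v" for n b
  proof -
    have "b \<in> set (if c n then v else u)" using that by simp
    then obtain i where "i < length (if c n then v else u)" and ib: "(if c n then v else u) ! i = b"
      unfolding in_set_conv_nth by blast
    then have i: "i < length u" using assms(1) by (simp split: if_splits)
    have "concat_words u v c (length u * n + i) = b"
    proof -
      have L: "length u \<noteq> 0" using i by linarith
      have "(length u * n + i) div length u = n" "(length u * n + i) mod length u = i"
        using i by (simp_all only: div_mult_self4[OF L] mod_mult_self4 div_less mod_less add_0_right)
      then show ?thesis using ib by (simp only: concat_words_def)
    qed
    moreover have "n \<le> length u * n + i"
      using i mult_le_mono1[of 1 "length u" n] by linarith
    ultimately show ?thesis by blast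
  qed
  from this[of True] this[of False] assms show ?thesis
    unfolding recurrent_def by auto
qed

lemma thin_hole_words:
  assumes "length v = length u" "length u \<ge> 2" "numeral_value 2 u < numeral_value 2 v"
    "True \<in> set u" "True \<in> set v" "False \<in> set u" "False \<in> set v"
    and "\<And>y. numeral_value 2 u \<le> (2 ^ length u - 1) * y \<Longrightarrow> (2 ^ length u - 1) * y \<le> numeral_value 2 v \<Longrightarrow>
           suffixes_avoid 2 a b y u \<and> suffixes_avoid 2 a b y v"
  shows "thin_hole a b"
proof -
  have "(2::real) ^ length u > 2"
    using power_increasing[OF assms(2), of "2::real"] by simp
  moreover have "u \<noteq> []" using assms(2) by auto
  moreover have "expansion 2 (shift n (concat_words u v c)) \<notin> {a<..<b}" for n c
    using assms(2,3) by (intro concat_words_avoid assms(1,8)) auto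
  moreover have "expansion 2 (concat_words u v c) = numeral_value 2 u / (2 ^ length u - 1)
    + (numeral_value 2 v - numeral_value 2 u) * expansion (2 ^ length u) c" for c
    using assms(2) by (intro expansion_concat_words assms(1)) auto
  moreover have "recurrent (concat_words u v c)" for c
    by (intro recurrent_concat_words assms)
  moreover have "numeral_value 2 v - numeral_value 2 u \<noteq> 0" using assms(3) by simp
  ultimately show ?thesis unfolding thin_hole_def by blast
qed

text \<open>Every 0 is followed by at least four 1s, so no orbit point is below binary 0.01111,
  which is 15/32.\<close>

lemma thin_hole_left: "thin_hole 0 (15/32)"
  by (rule thin_hole_words[where
        u = "[False, True, True, True, True, False, True, True, True, True]"
        and v = "[False, True, True, True, True, True, True, True, True, True]"]) simp_all

text \<open>The endpoints are the extreme orbit points around 1/2: 01 followed by 0010 repeated, and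
  10 followed by 0001 repeated.\<close>

lemma thin_hole_middle_left: "thin_hole (17/60) (31/60)"
  by (rule thin_hole_words[where u = "[False, False, False, True]" and v = "[False, False, True, False]"]) simp_all

text \<open>The words are 001 01 01 and 01 001 01. Points with first digit 0 stay below 01 repeated,
  which is 1/3. As two copies of 001 never meet, points with first digit 1 stay above 0.58, whereas
  100 repeated is only 4/7.\<close>

lemma thin_hole_middle: "thin_hole (1/3) (29/50)"
  by (rule thin_hole_words[where u = "[False, False, True, False, True, False, True]"
        and v = "[False, True, False, False, True, False, True]"]) simp_all

section \<open>The Thue--Morse substitution\<close>

text \<open>The substitution \<theta> in closed form.\<close>

definition thue_morse :: "bits \<Rightarrow> bits" where
  "thue_morse s n \<longleftrightarrow> s (n div 2) \<noteq> odd n"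

lemma shift_even_thue_morse: "shift (2 * n) (thue_morse s) = thue_morse (shift n s)"
  by (simp add: fun_eq_iff shift_def thue_morse_def)

lemma shift_odd_thue_morse:
  "shift (Suc (2 * n)) (thue_morse s) = case_nat (\<not> s n) (thue_morse (shift (Suc n) s))"
proof
  show "shift (Suc (2 * n)) (thue_morse s) i = case_nat (\<not> s n) (thue_morse (shift (Suc n) s)) i" for i
  proof (cases i)
    case (Suc j)
    have "Suc (2 * n) + Suc j = 2 * Suc n + j" by simp
    then show ?thesis unfolding Suc by (simp only: shift_def) (simp add: shift_def thue_morse_def)
  qed (simp add: shift_def thue_morse_def)
qed

lemma expansion_case_nat:
  "D \<ge> 2 \<Longrightarrow> expansion D (case_nat b s) = (of_bool b + expansion D s) / D"
  by (simp add: expansion_unfold[of D "case_nat b s"] shift_case_nat)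

text \<open>The images 01 and 10 have values 1 and D in base \<open>D\<close>, and a pair of digits
  acts as one digit in base D^2.\<close>

lemma expansion_thue_morse:
  assumes "D \<ge> 2"
  shows "expansion D (thue_morse s) = 1 / (D\<^sup>2 - 1) + (D - 1) * expansion (D\<^sup>2) s"
proof (rule expansion_unique)
  show "D\<^sup>2 \<ge> 2" using assms power_increasing[of 1 2 D] by simp
  show "\<bar>expansion D (thue_morse c)\<bar> \<le> 1 / (D - 1)" for c
    using expansion_nonneg[OF assms] expansion_le[OF assms] by simp
  show "expansion D (thue_morse c)
      = (1 + (D - 1) * of_bool (c 0) + expansion D (thue_morse (shift 1 c))) / D\<^sup>2" for c
    using assms expansion_unfold[OF assms, of "thue_morse c"] shift_odd_thue_morse[of 0 c]
    by (auto simp: expansion_case_nat[OF assms] thue_morse_def power2_eq_square field_simps)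
qed

section \<open>Iterates of the substitution and the bases 2^(2^k)\<close>

definition base :: "nat \<Rightarrow> real" where
  "base k = 2 ^ 2 ^ k"

definition base_prod :: "nat \<Rightarrow> real" where
  "base_prod k = (\<Prod>j<k. base j - 1)"

lemma base_Suc: "base (Suc k) = (base k)\<^sup>2"
  by (simp add: base_def power_mult flip: power_mult)

lemma base_ge_2: "base k \<ge> 2"
  using power_increasing[of 1 "2 ^ k" "2::real"] by (simp add: base_def)

lemma base_ge_4: "k > 0 \<Longrightarrow> base k \<ge> 4"
  using power_increasing[of 2 "2 ^ k" "2::real"] power_increasing[of 1 k "2::nat"] by (simp add: base_def)

lemma base_prod_Suc: "base_prod (Suc k) = base_prod k * (base k - 1)"
  by (simp add: base_prod_def)

lemma base_prod_pos: "base_prod k > 0"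
  unfolding base_prod_def using base_ge_2 by (intro prod_pos) (smt (verit))

text \<open>Each application of \<theta> squares the base and multiplies the scale by the current
  base minus 1. The constant term centres the Cantor set at 1/2.\<close>

lemma expansion_thue_morse_funpow:
  "expansion 2 ((thue_morse ^^ k) s)
    = 1/2 - base_prod k / (2 * (base k - 1)) + base_prod k * expansion (base k) s"
proof (induction k arbitrary: s)
  case 0
  show ?case by (simp add: base_prod_def base_def)
next
  case (Suc k)
  define b p x where "b = base k" and "p = base_prod k" and "x = expansion (base (Suc k)) s"
  have b: "b \<ge> 2" using base_ge_2 by (simp add: b_def)
  have "(thue_morse ^^ Suc k) s = (thue_morse ^^ k) (thue_morse s)"
    by (simp add: funpow_swap1)
  then have "expansion 2 ((thue_morse ^^ Suc k) s)
      = 1/2 - p / (2 * (b - 1)) + p * (1 / (b\<^sup>2 - 1) + (b - 1) * x)"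
    using Suc expansion_thue_morse[of b s] b by (simp add: b_def p_def x_def base_Suc)
  moreover have "p / (2 * (b - 1)) - p * (1 / (b\<^sup>2 - 1)) = p * (b - 1) / (2 * (b\<^sup>2 - 1))"
  proof -
    have "b\<^sup>2 - 1 = (b - 1) * (b + 1)" by (simp add: power2_eq_square algebra_simps)
    moreover have "p / (2 * e) - p * (1 / (e * (e + 2))) = p * e / (2 * (e * (e + 2)))" if "e > 0" for e
      using that by (simp add: divide_simps) (simp add: algebra_simps)
    from this[of "b - 1"] have "p / (2 * (b - 1)) - p * (1 / ((b - 1) * (b + 1)))
        = p * (b - 1) / (2 * ((b - 1) * (b + 1)))" using b by (simp add: add.commute)
    ultimately show ?thesis by (simp only:)
  qed
  ultimately have "expansion 2 ((thue_morse ^^ Suc k) s)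
      = 1/2 - p * (b - 1) / (2 * (b\<^sup>2 - 1)) + p * (b - 1) * x"
    by (simp add: algebra_simps)
  then show ?case by (simp add: base_prod_Suc base_Suc b_def p_def x_def)
qed

text \<open>For \<open>D > 2\<close> this is avoidance in the lexicographic order; it is used with
  base 4 and turned into base 2 at the end.\<close>

definition avoids :: "real \<Rightarrow> bits \<Rightarrow> bits \<Rightarrow> bits \<Rightarrow> bool" where
  "avoids D p q s \<longleftrightarrow> (\<forall>n. expansion D (shift n s) \<le> expansion D p \<or> expansion D q \<le> expansion D (shift n s))"

text \<open>At even positions \<theta> is monotone. At odd positions a digit precedes an image of
  \<theta>; images have base-4 values in [1/15, 4/15], so the result is at most 1/15 or at least
  4/15 and lies on one side of all images.\<close>

lemma avoids_thue_morse:
  assumes "avoids 4 p q s"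
  shows "avoids 4 (thue_morse p) (thue_morse q) (thue_morse s)"
  unfolding avoids_def
proof
  fix n
  have e: "expansion 4 (thue_morse t) = 1/15 + 3 * expansion 16 t" for t
    using expansion_thue_morse[of 4 t] by simp
  have bd: "0 \<le> expansion 16 t" "expansion 16 t \<le> 1/15" for t
    using expansion_nonneg[of 16 t] expansion_le[of 16 t] by auto
  show "expansion 4 (shift n (thue_morse s)) \<le> expansion 4 (thue_morse p)
      \<or> expansion 4 (thue_morse q) \<le> expansion 4 (shift n (thue_morse s))"
  proof (cases "even n")
    case True
    then obtain m where m: "n = 2 * m" by blast
    have "expansion 4 (shift m s) \<le> expansion 4 p \<or> expansion 4 q \<le> expansion 4 (shift m s)"
      using assms unfolding avoids_def by blast
    then have "expansion 16 (shift m s) \<le> expansion 16 p \<or> expansion 16 q \<le> expansion 16 (shift m s)"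
      using expansion_le_transfer[of 4 16] by auto
    then show ?thesis unfolding m shift_even_thue_morse e by auto
  next
    case False
    then obtain m where m: "n = Suc (2 * m)" by (metis oddE Suc_eq_plus1)
    show ?thesis
      unfolding m shift_odd_thue_morse
      using bd[of p] bd[of q] bd[of "shift (Suc m) s"]
      by (cases "s m") (auto simp: expansion_case_nat e)
  qed
qed

lemma avoids_thue_morse_funpow:
  "avoids 4 p q s \<Longrightarrow> avoids 4 ((thue_morse ^^ k) p) ((thue_morse ^^ k) q) ((thue_morse ^^ k) s)"
  by (induction k) (auto intro: avoids_thue_morse)

lemma avoids_base_2:
  assumes "avoids 4 p q s"
  shows "expansion 2 (shift n s) \<notin> {expansion 2 p<..<expansion 2 q}"
proof -
  have "expansion 4 (shift n s) \<le> expansion 4 p \<or> expansion 4 q \<le> expansion 4 (shift n s)"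
    using assms unfolding avoids_def by blast
  then have "expansion 2 (shift n s) \<le> expansion 2 p \<or> expansion 2 q \<le> expansion 2 (shift n s)"
    using expansion_le_transfer[of 4 2] by auto
  then show ?thesis by auto
qed

lemma recurrent_thue_morse: "recurrent (thue_morse s)"
proof -
  have "thue_morse s (2 * n) = s n" "thue_morse s (Suc (2 * n)) = (\<not> s n)" for n
    by (simp_all add: thue_morse_def)
  moreover have "2 * n \<ge> n" "Suc (2 * n) \<ge> n" for n :: nat by simp_all
  ultimately have "(\<exists>m\<ge>n. thue_morse s m) \<and> (\<exists>m\<ge>n. \<not> thue_morse s m)" for n
    by (cases "s n") blast+
  then show ?thesis unfolding recurrent_def by blast
qed

lemma expansion_alternating:
  assumes "D \<ge> 2"
  shows "expansion D odd = 1 / (D\<^sup>2 - 1)"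
proof -
  have "odd = thue_morse (\<lambda>_. False)" by (simp add: fun_eq_iff thue_morse_def)
  then show ?thesis using expansion_thue_morse[OF assms, of "\<lambda>_. False"] by simp
qed

lemma expansion_period_3:
  assumes "D \<ge> 2"
  shows "expansion D (\<lambda>n. n mod 3 = 0) = D\<^sup>2 / (D ^ 3 - 1)"
proof -
  have "(\<lambda>n::nat. n mod 3 = 0) = prepend [True, False, False] (\<lambda>n. n mod 3 = 0)"
  proof
    fix i :: nat
    consider "i = 0" | "i = 1" | "i = 2" | j where "i = 3 + j"
      using le_Suc_ex[of 3 i] by (cases "3 \<le> i") force+
    then show "i mod 3 = 0 \<longleftrightarrow> prepend [True, False, False] (\<lambda>n. n mod 3 = 0) i"
      by cases (simp_all add: prepend_nth)
  qed
  then have "expansion D (\<lambda>n. n mod 3 = 0) = (D\<^sup>2 + expansion D (\<lambda>n. n mod 3 = 0)) / D ^ 3"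
    using expansion_prepend[OF assms, of "[True, False, False]" "\<lambda>n. n mod 3 = 0"]
    by (simp add: power2_eq_square power3_eq_cube)
  moreover have "D ^ 3 > 1" using assms by simp
  moreover have "x = y / (z - 1)" if "x = (y + x) / z" "z > 1" for x y z :: real
  proof -
    have "x * z = y + x" using that by (simp add: eq_divide_eq)
    then show ?thesis using that(2) by (simp add: eq_divide_eq algebra_simps)
  qed
  ultimately show ?thesis by blast
qed

text \<open>The numbers with binary digits \<open>\<theta>\<^sup>k((01)\<^sup>\<infinity>)\<close> and \<open>\<theta>\<^sup>k((100)\<^sup>\<infinity>)\<close>.\<close>

definition gap_left :: "nat \<Rightarrow> real" where
  "gap_left k = 1/2 - base_prod k / (2 * (base k - 1)) + base_prod k / ((base k)\<^sup>2 - 1)"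

definition gap_right :: "nat \<Rightarrow> real" where
  "gap_right k = 1/2 - base_prod k / (2 * (base k - 1)) + base_prod k * ((base k)\<^sup>2 / (base k ^ 3 - 1))"

text \<open>Every infinite concatenation of \<open>01\<close> and \<open>001\<close> omits the points between \<open>(01)\<^sup>\<infinity>\<close> and
  \<open>(100)\<^sup>\<infinity>\<close>; words of equal length are obtained by joining the two in either order.\<close>

lemma thin_hole_gap:
  assumes "k > 0"
  shows "thin_hole (gap_left k) (gap_right k)"
proof -
  define u v where "u = [False, False, True, False, True]" and "v = [False, True, False, False, True]"
  have len: "length v = length u" "u \<noteq> []" by (simp_all add: u_def v_def)
  define b where "b = base k"
  have b: "b \<ge> 4" using base_ge_4[OF assms] by (simp add: b_def)
  define d where "d = numeral_value b v - numeral_value b u"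
  have "d = b\<^sup>2 * (b - 1)"
    by (simp add: d_def u_def v_def power2_eq_square power3_eq_cube algebra_simps)
  then have d: "d \<noteq> 0" using b by simp
  \<comment> \<open>1/15 and 16/63 are the base-4 values of 01 repeated and 100 repeated.\<close>
  have "expansion 4 (shift n (concat_words u v c)) \<notin> {1/15<..<16/63}" for n c
    by (rule concat_words_avoid) (simp_all add: u_def v_def)
  then have "avoids 4 odd (\<lambda>n. n mod 3 = 0) (concat_words u v c)" for c
    by (auto simp: avoids_def expansion_alternating expansion_period_3 not_less)
  then have av: "avoids 4 ((thue_morse ^^ k) odd) ((thue_morse ^^ k) (\<lambda>n. n mod 3 = 0))
      ((thue_morse ^^ k) (concat_words u v c))" for c
    by (rule avoids_thue_morse_funpow)
  have gl: "expansion 2 ((thue_morse ^^ k) odd) = gap_left k"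
    using b by (simp add: expansion_thue_morse_funpow gap_left_def expansion_alternating base_ge_2)
  have gr: "expansion 2 ((thue_morse ^^ k) (\<lambda>n. n mod 3 = 0)) = gap_right k"
    using b by (simp add: expansion_thue_morse_funpow gap_right_def expansion_period_3 base_ge_2)
  have rec: "recurrent ((thue_morse ^^ k) s)" for s
    using assms recurrent_thue_morse by (cases k) auto
  have "expansion 2 ((thue_morse ^^ k) (concat_words u v c))
      = (1/2 - base_prod k / (2 * (b - 1)) + base_prod k * (numeral_value b u / (b ^ length u - 1)))
        + (base_prod k * d) * expansion (b ^ length u) c" for c
  proof -
    have "expansion b (concat_words u v c)
        = numeral_value b u / (b ^ length u - 1) + d * expansion (b ^ length u) c"
      unfolding d_def using b by (intro expansion_concat_words len) auto
    then show ?thesis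
      unfolding expansion_thue_morse_funpow b_def[symmetric] by (simp add: distrib_left)
  qed
  moreover have "b ^ length u > 2" 
  proof -
    have "b ^ 1 \<le> b ^ length u" using b by (intro power_increasing) (auto simp: u_def)
    then show ?thesis using b by simp
  qed
  moreover have "base_prod k * d \<noteq> 0" using d base_prod_pos[of k] by simp
  moreover have "expansion 2 (shift n ((thue_morse ^^ k) (concat_words u v c))) \<notin> {gap_left k<..<gap_right k}" for n c
    using avoids_base_2[OF av] unfolding gl gr .
  ultimately show ?thesis
    unfolding thin_hole_def using rec
    by (intro exI[of _ "\<lambda>c. (thue_morse ^^ k) (concat_words u v c)"] exI[of _ "b ^ length u"]
        exI[of _ "1/2 - base_prod k / (2 * (b - 1)) + base_prod k * (numeral_value b u / (b ^ length u - 1))"]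
        exI[of _ "base_prod k * d"] conjI allI)
qed

section \<open>The critical length\<close>

text \<open>As \<open>base k\<close> is twice the product of the earlier bases, this is half the
  product of the 1 - 1/\<open>base j\<close> over j < k; the factor j = 0 produces the 1/4 of the
  critical length.\<close>

definition ratio :: "nat \<Rightarrow> real" where
  "ratio k = base_prod k / base k"

lemma ratio_Suc: "ratio (Suc k) = ratio k * (1 - 1 / base k)"
  using base_ge_2[of k]
  by (simp add: ratio_def base_prod_Suc base_Suc power2_eq_square field_simps)

lemma ratio_pos: "ratio k > 0"
  using base_prod_pos[of k] base_ge_2[of k] by (simp add: ratio_def)

lemma ratio_eq_prod: "ratio (Suc n) = 1/4 * (\<Prod>i<n. 1 - 1 / 2 ^ (2 ^ Suc i))"
proof (induction n)
  case 0
  show ?case by (simp add: ratio_def base_prod_def base_def)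
next
  case (Suc n)
  then show ?case by (subst ratio_Suc) (simp add: base_def)
qed

lemma le_two_power_Suc: "n \<le> 2 ^ Suc n"
  using less_exp[of "Suc n"] by simp

lemma base_inverse_tendsto: "(\<lambda>k. 1 / base k) \<longlonglongrightarrow> 0"
proof (rule tendsto_sandwich[of "\<lambda>_. 0" _ _ "\<lambda>k. (1 / 2) ^ k"])
  show "(\<lambda>k. (1 / 2) ^ k) \<longlonglongrightarrow> (0::real)" by (intro LIMSEQ_power_zero) auto
  have "1 / base k \<le> (1 / 2) ^ k" for k
    using power_increasing[of k "2 ^ k" "2::real"] less_exp[of k]
    by (auto simp: base_def power_divide intro!: divide_left_mono)
  then show "\<forall>\<^sub>F k in sequentially. 1 / base k \<le> (1 / 2) ^ k" by auto
  have "0 \<le> 1 / base k" for k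
    using base_ge_2[of k] by simp
  then show "\<forall>\<^sub>F k in sequentially. 0 \<le> 1 / base k" by auto
qed auto

lemma ratio_tendsto: "ratio \<longlonglongrightarrow> critical_length"
proof -
  define f :: "nat \<Rightarrow> real" where "f i = 1 - 1 / 2 ^ (2 ^ Suc i)" for i
  have "summable (\<lambda>i. norm (f i - 1))"
  proof (rule summable_comparison_test')
    show "summable (\<lambda>n. (1 / 2 :: real) ^ n)" by (intro summable_geometric) auto
    show "norm (norm (f n - 1)) \<le> (1 / 2) ^ n" if "n \<ge> 0" for n
      using power_increasing[OF le_two_power_Suc[of n], of "2::real"]
      by (auto simp: f_def power_divide intro!: divide_left_mono)
  qed
  then have "convergent_prod f"
    by (intro abs_convergent_prod_imp_convergent_prod summable_imp_abs_convergent_prod)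
  then have "(\<lambda>n. \<Prod>i<n. f i) \<longlonglongrightarrow> prodinf f"
    by (intro has_prod_imp_tendsto' convergent_prod_has_prod)
  then have "(\<lambda>n. 1/4 * (\<Prod>i<n. f i)) \<longlonglongrightarrow> 1/4 * prodinf f"
    by (intro tendsto_intros)
  moreover have "f = (\<lambda>i. 1 - 1 / 2 ^ (2 ^ Suc i))" by (simp add: fun_eq_iff f_def)
  ultimately have "(\<lambda>n. ratio (Suc n)) \<longlonglongrightarrow> critical_length"
    by (simp only: ratio_eq_prod critical_length_def)
  then show ?thesis by (simp add: filterlim_sequentially_Suc)
qed

lemma critical_length_le_ratio: "critical_length \<le> ratio k"
proof (rule decseq_ge[OF _ ratio_tendsto])
  show "decseq ratio"
  proof (rule decseq_SucI)
    show "ratio (Suc n) \<le> ratio n" for n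
      unfolding ratio_Suc using ratio_pos[of n] base_ge_2[of n]
      by (intro mult_left_le) auto
  qed
qed

text \<open>The correction factor makes the sequence increasing and keeps the limit, complementing
  the upper bounds \<open>ratio k\<close>.\<close>

lemma ratio_le_critical_length: "ratio k * (1 - 2 / base k) \<le> critical_length"
proof -
  have "incseq (\<lambda>k. ratio k * (1 - 2 / base k))"
  proof (rule incseq_SucI)
    fix n
    define x where "x = 1 / base n"
    have x: "0 \<le> x" "x \<le> 1/2" using base_ge_2[of n] by (simp_all add: x_def)
    have "1 - 2 * x \<le> (1 - x) * (1 - 2 * x\<^sup>2)"
    proof -
      have "(1 - x) * (1 - 2 * x\<^sup>2) - (1 - 2 * x) = x * (1 - 2 * x + 2 * x\<^sup>2)"
        by (simp add: power2_eq_square algebra_simps)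
      moreover have "\<dots> \<ge> 0" using x by (intro mult_nonneg_nonneg) auto
      ultimately show ?thesis by linarith
    qed
    then have "ratio n * (1 - 2 * x) \<le> ratio n * ((1 - x) * (1 - 2 * x\<^sup>2))"
      using ratio_pos[of n] by (intro mult_left_mono) auto
    then show "ratio n * (1 - 2 / base n) \<le> ratio (Suc n) * (1 - 2 / base (Suc n))"
      by (simp add: ratio_Suc base_Suc x_def power_divide mult.assoc)
  qed
  moreover have "(\<lambda>k. ratio k * (1 - 2 * (1 / base k))) \<longlonglongrightarrow> critical_length * (1 - 2 * 0)"
    by (intro tendsto_intros ratio_tendsto base_inverse_tendsto)
  ultimately show ?thesis using incseq_le[of "\<lambda>k. ratio k * (1 - 2 / base k)" critical_length k] by simp
qed

lemma ratio_5: "ratio 5 = 3 * 15 * 255 * 65535 / 4294967296"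
  by (simp add: ratio_def base_prod_def base_def numeral_eq_Suc lessThan_Suc)

lemma critical_length_approx: "\<bar>critical_length - 0.175092\<bar> \<le> 0.0000005"
  using critical_length_le_ratio[of 5] ratio_le_critical_length[of 5]
  unfolding ratio_5 by (simp add: base_def abs_if)

section \<open>Position of the gaps\<close>

lemma gap_left_eq: "gap_left k = 1/2 - base_prod k / (2 * (base k + 1))"
proof -
  have "p / (2 * (b - 1)) - p / (b\<^sup>2 - 1) = p / (2 * (b + 1))" if "b \<ge> 2" for p b :: real
  proof -
    have "b\<^sup>2 - 1 = (b - 1) * (b + 1)" by (simp add: power2_eq_square algebra_simps)
    moreover have "p / (2 * (b - 1)) - p / ((b - 1) * (b + 1)) = p / (2 * (b + 1))"
      using that by (simp add: divide_simps) (simp add: algebra_simps)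
    ultimately show ?thesis by simp
  qed
  from this[OF base_ge_2, of "base_prod k" k] show ?thesis
    unfolding gap_left_def by linarith
qed

lemma gap_left_ge: "1/2 - ratio k / 2 \<le> gap_left k"
proof -
  have "base_prod k / (2 * (base k + 1)) \<le> base_prod k / (2 * base k)"
    using base_prod_pos[of k] base_ge_2[of k] by (intro divide_left_mono) auto
  then show ?thesis by (simp add: gap_left_eq ratio_def)
qed

text \<open>Writing p and b for \<open>base_prod k\<close> and \<open>base k\<close>, p/(b + 1) is
  at least \<open>ratio (Suc k)\<close>, because (b - 1)(b + 1) < b^2.\<close>

lemma gap_left_le: "gap_left k \<le> 1/2 - critical_length / 2"
proof -
  have "base_prod k * (1 / base k * (1 - 1 / base k)) \<le> base_prod k * (1 / (base k + 1))"
    using base_prod_pos[of k] base_ge_2[of k]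
    by (intro mult_left_mono) (simp_all add: divide_simps, simp add: algebra_simps)
  then have "ratio (Suc k) \<le> base_prod k / (base k + 1)"
    unfolding ratio_Suc by (simp add: ratio_def)
  then have "critical_length \<le> base_prod k / (base k + 1)"
    using critical_length_le_ratio[of "Suc k"] by (rule order_trans[rotated])
  then have "critical_length / 2 \<le> base_prod k / (base k + 1) / 2" by (rule divide_right_mono) simp
  then show ?thesis by (simp add: gap_left_eq mult.commute)
qed

lemma gap_right_ge: "1/2 + ratio k * (1 - 2 / base k) / 2 \<le> gap_right k"
proof -
  define b p where "b = base k" and "p = base_prod k"
  have b: "b \<ge> 2" and p: "p > 0" using base_ge_2 base_prod_pos by (auto simp: b_def p_def)
  have "1 / b \<le> b\<^sup>2 / (b ^ 3 - 1)"
  proof -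
    have "b ^ 3 > 1" using b by simp
    then show ?thesis using b by (simp add: divide_simps power2_eq_square power3_eq_cube)
  qed
  then have "p * (1 / b) \<le> p * (b\<^sup>2 / (b ^ 3 - 1))" using p by (intro mult_left_mono) auto
  moreover have "p / (2 * (b - 1)) \<le> p / b * (1 + 2 / b) / 2"
  proof -
    have "1 / (b - 1) \<le> 1 / b * (1 + 2 / b)"
      using b by (simp add: divide_simps) (simp add: algebra_simps)
    then have "p / 2 * (1 / (b - 1)) \<le> p / 2 * (1 / b * (1 + 2 / b))"
      using p by (intro mult_left_mono) auto
    then show ?thesis by (simp add: mult_ac)
  qed
  moreover have "p * (1 / b) - p / b * (1 + 2 / b) / 2 = p / b * (1 - 2 / b) / 2"
  proof -
    have "q - q * (1 + t) / 2 = q * (1 - t) / 2" for q t :: real by (simp add: field_simps)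
    from this[of "p / b" "2 / b"] show ?thesis by simp
  qed
  ultimately show ?thesis unfolding gap_right_def ratio_def b_def[symmetric] p_def[symmetric]
    by linarith
qed

text \<open>Hence a hole of subcritical length that starts between \<open>gap_left k\<close> and
  \<open>gap_left (Suc k)\<close> is contained in the gap number \<open>k\<close>.\<close>

lemma gap_chain:
  assumes "k > 0"
  shows "gap_left (Suc k) + critical_length \<le> gap_right k"
proof -
  define b p where "b = base k" and "p = base_prod k"
  have b: "b \<ge> 4" and p: "p > 0" using base_ge_4[OF assms] base_prod_pos by (auto simp: b_def p_def)
  \<comment> \<open>Three further factors of the infinite product bound the critical length by
    \<open>p * r\<close>, which is sharp enough and leaves an inequality in \<open>b\<close>
    alone.\<close>
  define r where "r = (b - 1) * (b\<^sup>2 - 1) * (b ^ 4 - 1) / b ^ 8"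
  have "critical_length \<le> ratio (Suc (Suc (Suc k)))" by (rule critical_length_le_ratio)
  also have "\<dots> = p * r"
    by (simp add: ratio_def base_prod_Suc base_Suc r_def b_def p_def mult.assoc flip: power_mult)
  finally have c: "critical_length \<le> p * r" .
  have b3: "b ^ 3 > 1" using b by simp
  have "b ^ 3 - 1 = (b - 1) * (b\<^sup>2 + b + 1)" by (simp add: power2_eq_square power3_eq_cube algebra_simps)
  moreover have "b\<^sup>2 + b + 1 > 0" using b by (intro add_nonneg_pos) auto
  ultimately have "1 / (2 * (b - 1)) = (b\<^sup>2 + b + 1) / (2 * (b ^ 3 - 1))"
    using b by (simp add: divide_simps)
  then have "b\<^sup>2 / (b ^ 3 - 1) - 1 / (2 * (b - 1)) = (b\<^sup>2 - b - 1) / (2 * (b ^ 3 - 1))"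
  proof -
    assume eq: "1 / (2 * (b - 1)) = (b\<^sup>2 + b + 1) / (2 * (b ^ 3 - 1))"
    have "x / z - y / (2 * z) = (2 * x - y) / (2 * z)" if "z > 0" for x y z :: real
      using that by (simp add: field_simps)
    from this[of "b ^ 3 - 1" "b\<^sup>2" "b\<^sup>2 + b + 1"] show ?thesis
      unfolding eq using b3 by simp
  qed
  then have "b\<^sup>2 / (b ^ 3 - 1) - 1 / (2 * (b - 1)) + (b - 1) / (2 * (b\<^sup>2 + 1))
      = (b\<^sup>2 - b - 1) / (2 * (b ^ 3 - 1)) + (b - 1) / (2 * (b\<^sup>2 + 1))"
    by simp
  also have "\<dots> = b * (b ^ 3 - b\<^sup>2 - 1) / ((b ^ 3 - 1) * (b\<^sup>2 + 1))"
  proof -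
    have pos: "b\<^sup>2 + 1 > 0" using b by (simp add: add_nonneg_pos)
    have poly: "(b\<^sup>2 - b - 1) * (b\<^sup>2 + 1) + (b - 1) * (b ^ 3 - 1) = 2 * (b * (b ^ 3 - b\<^sup>2 - 1))"
      by (simp add: power2_eq_square power3_eq_cube algebra_simps)
    have "x / (2 * y) + z / (2 * w) = u / (y * w)"
      if "x * w + z * y = 2 * u" "y > 0" "w > 0" for x y z w u :: real
      using that by (simp add: field_simps)
    from this[OF poly _ pos] show ?thesis using b3 by simp
  qed
  also have "\<dots> \<ge> r"
  proof -
    have pos: "(b ^ 3 - 1) * (b\<^sup>2 + 1) > 0" using b b3 by (intro mult_pos_pos add_nonneg_pos) auto
    have "b * (b ^ 3 - b\<^sup>2 - 1) * b ^ 8 - (b - 1) * (b\<^sup>2 - 1) * (b ^ 4 - 1) * ((b ^ 3 - 1) * (b\<^sup>2 + 1))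
        = b ^ 5 * (b\<^sup>2 * (b - 2) - 2) + b ^ 4 + b ^ 3 + (b - 1)"
      by (simp add: eval_nat_numeral algebra_simps)
    moreover have "b\<^sup>2 * (b - 2) \<ge> 1 * 2"
      using b by (intro mult_mono) auto
    then have "b ^ 5 * (b\<^sup>2 * (b - 2) - 2) + b ^ 4 + b ^ 3 + (b - 1) \<ge> 0"
      using b by (intro add_nonneg_nonneg mult_nonneg_nonneg) auto
    ultimately have "(b - 1) * (b\<^sup>2 - 1) * (b ^ 4 - 1) * ((b ^ 3 - 1) * (b\<^sup>2 + 1))
        \<le> b * (b ^ 3 - b\<^sup>2 - 1) * b ^ 8" by linarith
    then show ?thesis unfolding r_def using pos b by (subst frac_le_eq[THEN iffD2]) (auto simp: divide_nonpos_pos)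
  qed
  finally have "p * r \<le> p * (b\<^sup>2 / (b ^ 3 - 1) - 1 / (2 * (b - 1)) + (b - 1) / (2 * (b\<^sup>2 + 1)))"
    using p by (intro mult_left_mono) auto
  moreover have "gap_right k - gap_left (Suc k)
      = p * (b\<^sup>2 / (b ^ 3 - 1) - 1 / (2 * (b - 1)) + (b - 1) / (2 * (b\<^sup>2 + 1)))"
    unfolding gap_right_def gap_left_eq base_prod_Suc base_Suc b_def[symmetric] p_def[symmetric]
    by (simp add: algebra_simps)
  ultimately show ?thesis using c by linarith
qed

lemma gap_left_1: "gap_left 1 = 2/5"
  by (simp add: gap_left_eq base_prod_def base_def)

lemma thin_hole_left_half:
  assumes "0 < a" "a < b" "b - a < critical_length" "a + b \<le> 1"
  shows "thin_hole a b"
proof -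
  have c: "critical_length < 0.1751" using critical_length_le_ratio[of 5] by (simp add: ratio_5)
  \<comment> \<open>The thresholds are left ends of explicit holes, then \<open>gap_left 1\<close>,
    then the limit of \<open>gap_left\<close>. Gap number 0 ends at 4/7, short of 2/5 plus the
    critical length, so [1/3, 2/5] needs its own words.\<close>
  consider "a \<le> 17/60" | "17/60 \<le> a" "a \<le> 1/3" | "1/3 \<le> a" "a \<le> 2/5"
    | "2/5 \<le> a" "a < 1/2 - critical_length / 2" | "1/2 - critical_length / 2 \<le> a" by linarith
  then show ?thesis
  proof cases
    case 1
    then show ?thesis using assms c by (intro thin_hole_mono[OF thin_hole_left]) auto
  next
    case 2
    then show ?thesis using assms c by (intro thin_hole_mono[OF thin_hole_middle_left]) auto
  next
    case 3
    then show ?thesis using assms c by (intro thin_hole_mono[OF thin_hole_middle]) auto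
  next
    case 4
    \<comment> \<open>As \<open>a\<close> is below the limit of the left ends, there is a least
      \<open>m > 0\<close> with \<open>a < gap_left (Suc m)\<close>; minimality gives
      \<open>gap_left m \<le> a\<close>.\<close>
    then have "critical_length < 1 - 2 * a" by linarith
    then obtain n where "ratio n < 1 - 2 * a"
      using order_tendstoD(2)[OF ratio_tendsto] by (metis eventually_sequentially order_refl)
    then have n: "a < gap_left n" using gap_left_ge[of n] by linarith
    define m where "m = (LEAST m. m > 0 \<and> a < gap_left (Suc m))"
    have "gap_left 0 \<le> a" using 4 by (simp add: gap_left_eq base_prod_def base_def)
    then have "n \<noteq> 0" using n by (metis not_le)
    moreover have "n \<noteq> 1" using n gap_left_1 4(1) by (metis not_le)
    ultimately have "n - 1 > 0 \<and> a < gap_left (Suc (n - 1))" using n by simp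
    then have ex: "\<exists>m. m > 0 \<and> a < gap_left (Suc m)" by blast
    have m: "m > 0" "a < gap_left (Suc m)"
      using LeastI_ex[OF ex] by (simp_all add: m_def)
    have "gap_left m \<le> a"
    proof (cases "m = 1")
      case False
      then have "m - 1 > 0" "m - 1 < m" using m(1) by simp_all
      then have "\<not> a < gap_left (Suc (m - 1))"
        using not_less_Least[of "m - 1"] unfolding m_def by blast
      then show ?thesis using m(1) by simp
    qed (use 4 gap_left_1 in simp)
    moreover have "b \<le> gap_right m" using gap_chain[OF m(1)] m(2) assms(3) by linarith
    ultimately show ?thesis by (rule thin_hole_mono[OF thin_hole_gap[OF m(1)]])
  next
    case 5
    \<comment> \<open>Every gap starts at or before \<open>a\<close>, and
      \<open>a + b \<le> 1\<close> puts \<open>b\<close> below the limit of the lower bounds on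
      \<open>gap_right\<close>, so a late gap reaches \<open>b\<close>.\<close>
    then have "2 * b - 1 < critical_length"
      using assms(3,4) by (smt (verit) field_sum_of_halves)
    moreover have "(\<lambda>k. ratio k * (1 - 2 * (1 / base k))) \<longlonglongrightarrow> critical_length * (1 - 2 * 0)"
      by (intro tendsto_intros ratio_tendsto base_inverse_tendsto)
    ultimately have "\<forall>\<^sub>F k in sequentially. 2 * b - 1 < ratio k * (1 - 2 * (1 / base k))"
      by (intro order_tendstoD(1)) auto
    then obtain k where k: "k > 0" "2 * b - 1 < ratio k * (1 - 2 / base k)"
      unfolding eventually_sequentially by (metis le_SucI less_Suc_eq_0_disj order_refl times_divide_eq_right mult.right_neutral)
    have "b \<le> y" if "1/2 + x / 2 \<le> y" "2 * b - 1 < x" for x y using that by linarith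
    from this[OF gap_right_ge k(2)] have "b \<le> gap_right k" .
    moreover have "gap_left k \<le> a" using gap_left_le[of k] 5 by linarith
    ultimately show ?thesis by (intro thin_hole_mono[OF thin_hole_gap[OF k(1)]])
  qed
qed

section \<open>Sharpness\<close>

text \<open>The number t_k with binary digits \<theta>^k(000...).\<close>

definition hole_left :: "nat \<Rightarrow> real" where
  "hole_left k = 1/2 - base_prod k / (2 * (base k - 1))"

lemma expansion_one: "D \<ge> 2 \<Longrightarrow> expansion D (\<lambda>_. True) = 1 / (D - 1)"
  using expansion_compl[of D "\<lambda>_. False"] by simp

lemma expansion_thue_morse_funpow_const:
  "expansion 2 ((thue_morse ^^ k) (\<lambda>_. False)) = hole_left k"
  "expansion 2 ((thue_morse ^^ k) (\<lambda>_. True)) = 1 - hole_left k"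
proof -
  have "1/2 - p / (2 * d) + p * (1 / d) = 1 - (1/2 - p / (2 * d))" for p d :: real
    by (cases "d = 0") (simp_all add: field_simps)
  then show "expansion 2 ((thue_morse ^^ k) (\<lambda>_. True)) = 1 - hole_left k"
    unfolding expansion_thue_morse_funpow hole_left_def expansion_one[OF base_ge_2] .
  show "expansion 2 ((thue_morse ^^ k) (\<lambda>_. False)) = hole_left k"
    unfolding expansion_thue_morse_funpow hole_left_def by simp
qed

definition hole_avoiding :: "nat \<Rightarrow> bits set" where
  "hole_avoiding k = {s. \<forall>n. expansion 2 (shift n s) \<notin> {hole_left k<..<1 - hole_left k}}"

lemma shift_hole_avoiding: "s \<in> hole_avoiding k \<Longrightarrow> shift n s \<in> hole_avoiding k"
  by (simp add: hole_avoiding_def)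

text \<open>As \<theta>^k(000...) begins with 0, its image is at most 01 followed by 10 repeated,
  which is 5/12.\<close>

lemma hole_left_Suc_le: "hole_left (Suc k) \<le> 5/12"
proof -
  define s where "s = (thue_morse ^^ k) (\<lambda>_. False)"
  have "\<not> s 0"
    unfolding s_def by (induction k) (auto simp: thue_morse_def)
  then have "expansion 4 s \<le> 1/12"
    using expansion_unfold[of 4 s] expansion_le[of 4 "shift 1 s"] by simp
  moreover have "hole_left (Suc k) = expansion 2 (thue_morse s)"
    unfolding expansion_thue_morse_funpow_const(1)[symmetric] s_def by simp
  ultimately show ?thesis using expansion_thue_morse[of 2 s] by simp
qed

text \<open>Points of [1/3, 5/12] begin with 01 and those of [7/12, 2/3] with 10; two doublings map
  each interval onto the middle third.\<close>

lemma middle_third_step: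
  assumes "expansion 2 s \<in> {1/3..2/3}" "expansion 2 s \<notin> {5/12<..<7/12}"
  shows "s 1 \<longleftrightarrow> \<not> s 0" "expansion 2 (shift 2 s) \<in> {1/3..2/3}"
proof -
  have "expansion 2 s = (2 * of_bool (s 0) + of_bool (s 1) + expansion 2 (shift 2 s)) / 4"
  proof -
    have "shift 1 s 0 = s 1" "shift 1 (shift 1 s) = shift 2 s"
      by (simp_all add: shift_def numeral_2_eq_2)
    then have "expansion 2 (shift 1 s) = (of_bool (s 1) + expansion 2 (shift 2 s)) / 2"
      using expansion_unfold[of 2 "shift 1 s"] by simp
    then show ?thesis using expansion_unfold[of 2 s] by simp
  qed
  then show "s 1 \<longleftrightarrow> \<not> s 0" "expansion 2 (shift 2 s) \<in> {1/3..2/3}"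
    using assms expansion_nonneg[of 2 "shift 2 s"] expansion_le[of 2 "shift 2 s"]
    by (cases "s 0"; cases "s 1"; force)+
qed

text \<open>Iterating the previous step splits the digits into pairs 01 and 10, so \<theta> can be
  undone; its monotonicity pulls the hole back to index \<open>k\<close>.\<close>

lemma hole_avoiding_middle_third:
  assumes s: "s \<in> hole_avoiding (Suc k)" and mid: "expansion 2 s \<in> {1/3..2/3}"
  shows "s \<in> thue_morse ` hole_avoiding k"
proof
  define z where "z n = s (2 * n)" for n
  have hole: "expansion 2 (shift n s) \<notin> {5/12<..<7/12}" for n
  proof -
    have "expansion 2 (shift n s) \<notin> {hole_left (Suc k)<..<1 - hole_left (Suc k)}"
      using s unfolding hole_avoiding_def by blast
    then show ?thesis using hole_left_Suc_le[of k] by auto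
  qed
  have mid: "expansion 2 (shift (2 * n) s) \<in> {1/3..2/3}" for n
  proof (induction n)
    case (Suc n)
    from middle_third_step(2)[OF this hole] show ?case by (simp add: add.commute)
  qed (use mid in simp)
  have odd: "s (Suc (2 * n)) = (\<not> s (2 * n))" for n
    using middle_third_step(1)[OF mid hole, of n] by (simp add: shift_def)
  show eq: "s = thue_morse z"
  proof
    fix i
    show "s i = thue_morse z i"
    proof (cases "even i")
      case True
      then obtain m where "i = 2 * m" by (rule evenE)
      then show ?thesis by (simp add: thue_morse_def z_def)
    next
      case False
      then obtain m where "i = 2 * m + 1" by (rule oddE)
      then show ?thesis using odd[of m] by (simp add: thue_morse_def z_def)
    qed
  qed
  have "expansion 2 (shift n z) \<notin> {hole_left k<..<1 - hole_left k}" for n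
  proof
    assume "expansion 2 (shift n z) \<in> {hole_left k<..<1 - hole_left k}"
    then have less: "expansion 2 ((thue_morse ^^ k) (\<lambda>_. False)) < expansion 2 (shift n z)"
        "expansion 2 (shift n z) < expansion 2 ((thue_morse ^^ k) (\<lambda>_. True))"
      unfolding expansion_thue_morse_funpow_const by auto
    \<comment> \<open>An image has base-2 value 1/3 plus the base-4 value of its source, and passing
      from base 2 to base 4 keeps inequalities strict.\<close>
    have mono: "expansion 2 (thue_morse x) < expansion 2 (thue_morse y)"
      if "expansion 2 x < expansion 2 y" for x y
      using expansion_less_transfer[of 2 4 x y] that by (simp add: expansion_thue_morse)
    have "hole_left (Suc k) < expansion 2 (shift (2 * n) s)"
         "expansion 2 (shift (2 * n) s) < 1 - hole_left (Suc k)"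
      using mono[OF less(1)] mono[OF less(2)]
        expansion_thue_morse_funpow_const[of "Suc k"]
      by (simp_all add: eq shift_even_thue_morse)
    then show False using s unfolding hole_avoiding_def by auto
  qed
  then show "z \<in> hole_avoiding k" by (simp add: hole_avoiding_def)
qed

text \<open>A point below 1/3 doubles to one below 2/3, hence again below 1/3, so every digit is 0.
  Above 2/3 take complements.\<close>

lemma constant_if_never_middle_third:
  assumes "\<And>n. expansion 2 (shift n s) \<notin> {1/3..2/3}"
  shows "s = (\<lambda>_. False) \<or> s = (\<lambda>_. True)"
proof -
  have low: "t = (\<lambda>_. False)"
    if t: "\<And>n. expansion 2 (shift n t) \<notin> {1/3..2/3}" "expansion 2 t < 1/3" for t
  proof -
    have step: "\<not> u 0 \<and> expansion 2 (shift 1 u) < 2/3" if "expansion 2 u < 1/3" for u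
      using expansion_unfold[of 2 u] expansion_nonneg[of 2 "shift 1 u"] that
      by (cases "u 0") auto
    have less: "expansion 2 (shift n t) < 1/3" for n
    proof (induction n)
      case (Suc n)
      from step[OF this] t(1)[of "Suc n"] show ?case by auto
    qed (use t(2) in simp)
    have "\<not> t n" for n using step[OF less[of n]] by (simp add: shift_def)
    then show ?thesis by auto
  qed
  consider "expansion 2 s < 1/3" | "expansion 2 s > 2/3" using assms[of 0] by force
  then show ?thesis
  proof cases
    case 2
    have c: "expansion 2 (shift n (\<lambda>i. \<not> s i)) = 1 - expansion 2 (shift n s)" for n
      using expansion_compl[of 2 "shift n s"] by (simp add: shift_def)
    have "expansion 2 (\<lambda>i. \<not> s i) < 1/3" using c[of 0] 2 by simp
    moreover have "expansion 2 (shift n (\<lambda>i. \<not> s i)) \<notin> {1/3..2/3}" for n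
      unfolding c using assms[of n] by auto
    ultimately have "(\<lambda>i. \<not> s i) = (\<lambda>_. False)" by (intro low)
    then show ?thesis by (simp add: fun_eq_iff)
  qed (use low assms in blast)
qed

text \<open>A sequence is determined by its first n digits and its shift, and there are countably
  many words.\<close>

lemma countable_shift_vimage:
  assumes "countable A"
  shows "countable {s. shift n s \<in> A}"
proof -
  have "{s. shift n s \<in> A} \<subseteq> (\<lambda>(w, t). prepend w t) ` (UNIV \<times> A)"
  proof
    fix s assume "s \<in> {s. shift n s \<in> A}"
    moreover have "s = (\<lambda>(w, t). prepend w t) (map s [0..<n], shift n s)"
      by (simp add: fun_eq_iff prepend_nth shift_def)
    ultimately show "s \<in> (\<lambda>(w, t). prepend w t) ` (UNIV \<times> A)" by blast
  qed
  then show ?thesis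
    by (rule countable_subset) (intro countable_image countable_SIGMA assms countableI_type)
qed

text \<open>The hole of index 0 is (0, 1), which only constant sequences avoid. For larger index a
  nonconstant sequence has a shift in the middle third, where \<theta> can be undone.\<close>

lemma countable_hole_avoiding: "countable (hole_avoiding k)"
proof (induction k)
  case 0
  have "hole_avoiding 0 \<subseteq> {\<lambda>_. False, \<lambda>_. True}"
  proof
    fix s assume "s \<in> hole_avoiding 0"
    then have "expansion 2 (shift n s) \<notin> {0<..<1}" for n
      by (simp add: hole_avoiding_def hole_left_def base_prod_def base_def)
    moreover have "x \<notin> {1/3..2/3}" if "x \<notin> {0<..<1}" for x :: real using that by auto
    ultimately have "expansion 2 (shift n s) \<notin> {1/3..2/3}" for n by blast
    then show "s \<in> {\<lambda>_. False, \<lambda>_. True}" using constant_if_never_middle_third[of s] by blast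
  qed
  then show ?case by (rule countable_subset) simp
next
  case (Suc k)
  have "hole_avoiding (Suc k)
      \<subseteq> {\<lambda>_. False, \<lambda>_. True} \<union> (\<Union>n. {s. shift n s \<in> thue_morse ` hole_avoiding k})"
  proof
    fix s assume s: "s \<in> hole_avoiding (Suc k)"
    show "s \<in> {\<lambda>_. False, \<lambda>_. True} \<union> (\<Union>n. {s. shift n s \<in> thue_morse ` hole_avoiding k})"
      using hole_avoiding_middle_third[OF shift_hole_avoiding[OF s]] constant_if_never_middle_third[of s] by blast
  qed
  moreover have "countable (\<Union>n. {s. shift n s \<in> thue_morse ` hole_avoiding k})"
    by (intro countable_UN countable_shift_vimage countable_image Suc countableI_type)
  ultimately show ?case by (meson countable_subset countable_Un countable_insert countable_empty)
qed

lemma countable_avoiding_set: "countable (avoiding_set (hole_left k) (1 - hole_left k))"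
proof (rule countable_subset)
  show "avoiding_set (hole_left k) (1 - hole_left k) \<subseteq> expansion 2 ` hole_avoiding k"
  proof
    fix x assume "x \<in> avoiding_set (hole_left k) (1 - hole_left k)"
    then have x: "x \<in> {0..1}" "(doubling ^^ n) x \<notin> {hole_left k<..<1 - hole_left k}" for n
      by (simp_all add: avoiding_set_def)
    have "expansion 2 (shift n (itinerary x)) = (doubling ^^ n) x" for n
      using doubling_funpow_in_unit[OF x(1)] by (simp add: shift_itinerary expansion_itinerary)
    then have "itinerary x \<in> hole_avoiding k" using x(2) by (simp add: hole_avoiding_def)
    then show "x \<in> expansion 2 ` hole_avoiding k"
      using expansion_itinerary[OF x(1)] by force
  qed
qed (intro countable_image countable_hole_avoiding)

lemma hole_length_tendsto: "(\<lambda>k. 1 - 2 * hole_left k) \<longlonglongrightarrow> critical_length"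
proof -
  have "(\<lambda>k. ratio k / (1 - 1 / base k)) \<longlonglongrightarrow> critical_length / (1 - 0)"
    by (intro tendsto_intros ratio_tendsto base_inverse_tendsto) auto
  moreover have "ratio k / (1 - 1 / base k) = 1 - 2 * hole_left k" for k
    using base_ge_2[of k] by (simp add: ratio_def hole_left_def field_simps)
  ultimately show ?thesis by simp
qed

lemma hole_left_bounds:
  assumes "k > 0"
  shows "0 < hole_left k" "hole_left k < 1 - hole_left k"
proof -
  \<comment> \<open>For k > 0 the ratio is at most 1/4, which keeps the endpoint positive; at k = 0
    it would be 0.\<close>
  have "base_prod k \<le> base k / 4"
  proof -
    obtain j where "k = Suc j" using assms not0_implies_Suc by blast
    moreover have "(\<Prod>i<j. 1 - 1 / 2 ^ (2 ^ Suc i) :: real) \<le> 1"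
      by (intro prod_le_1) auto
    ultimately have "ratio k \<le> 1/4" using ratio_eq_prod[of j] by simp
    then show ?thesis using base_ge_2[of k] by (simp add: ratio_def field_simps)
  qed
  then show "0 < hole_left k" using base_ge_2[of k] by (simp add: hole_left_def field_simps)
  show "hole_left k < 1 - hole_left k"
    using base_prod_pos[of k] base_ge_2[of k] by (simp add: hole_left_def)
qed

theorem mainTheorem4:
  shows "(\<forall>a b :: real. 0 < a \<and> a < b \<and> b < 1 \<and> b - a < critical_length
            \<longrightarrow> hausdorff_dim (avoiding_set a b) > 0) \<and>
         (\<forall>c > critical_length.
            \<not> (\<forall>a b :: real. 0 < a \<and> a < b \<and> b < 1 \<and> b - a < c
                  \<longrightarrow> hausdorff_dim (avoiding_set a b) > 0)) \<and>
         \<bar>critical_length - 0.175092\<bar> \<le> 0.0000005"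
proof (intro conjI allI impI critical_length_approx)
  fix a b :: real
  assume ab: "0 < a \<and> a < b \<and> b < 1 \<and> b - a < critical_length"
  have "thin_hole a b"
  proof (cases "a + b \<le> 1")
    case False
    then have "thin_hole (1 - b) (1 - a)" using ab by (intro thin_hole_left_half) auto
    from thin_hole_reflect[OF this] show ?thesis by simp
  qed (use ab in \<open>intro thin_hole_left_half; simp\<close>)
  then show "hausdorff_dim (avoiding_set a b) > 0" by (rule thin_hole_dim_pos)
next
  fix c :: real
  assume "c > critical_length"
  then have "\<forall>\<^sub>F k in sequentially. 1 - 2 * hole_left k < c"
    by (rule order_tendstoD(2)[OF hole_length_tendsto])
  then obtain N where N: "\<And>k. k \<ge> N \<Longrightarrow> 1 - 2 * hole_left k < c"
    unfolding eventually_sequentially by blast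
  \<comment> \<open>The successor makes the index positive, so that \<open>0 < a\<close>.\<close>
  define a where "a = hole_left (Suc N)"
  have "0 < a" "a < 1 - a" "1 - a < 1" "1 - a - a < c"
    using hole_left_bounds[of "Suc N"] N[of "Suc N"] by (simp_all add: a_def)
  moreover have "hausdorff_dim (avoiding_set a (1 - a)) = 0"
    unfolding a_def by (intro hausdorff_dim_countable countable_avoiding_set)
  ultimately show "\<not> (\<forall>a b :: real. 0 < a \<and> a < b \<and> b < 1 \<and> b - a < c
                  \<longrightarrow> hausdorff_dim (avoiding_set a b) > 0)"
    by (metis less_irrefl)
qed

end
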